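(* Let $p>1$ and let $V:\mathbb{Z}^N\to\mathbb{R}$ be a potential on the lattice graph $\mathbb{Z}^N$ satisfying $$-1<\inf_{x\in\mathbb{Z}^N}V(x)\le\sup_{x\in\mathbb{Z}^N}V(x)=V_\infty<\infty\quad\text{with}\quad V_\infty=\lim_{|x|\to\infty}V(x).$$ Then the problem $$-\Delta_pu(x)+V(x)|u|^{p-2}u=|u|^{p-2}u\log|u|^p,\quad x\in\mathbb{Z}^N,$$ has a ground state solution $u$. Moreover, $u(x)>0$ for all $x\in\mathbb{Z}^N$ or $u(x)<0$ for all $x\in\mathbb{Z}^N$.
   Context: The lattice graph $\mathbb{Z}^N$ has vertex set $\mathbb{Z}^N$ and edges $\{x,y\}$ with $\sum_{i=1}^N|x_i-y_i|=1$ (written $x\sim y$). All functions are real valued, $\mu$ is the counting measure, $\int_{\mathbb{Z}^N}f\,d\mu=\sum_xf(x)$. $\Delta_pu(x)=\sum_{y\sim x}|u(y)-u(x)|^{p-2}(u(y)-u(x))$ (with $|t|^{p-2}t=0$ at $t=0$), $|\nabla u(x)|_p=\left(\frac12\sum_{y\sim x}|u(y)-u(x)|^p\right)^{1/p}$. $W^{1,p}(\mathbb{Z}^N)$ is the completion of the finitely supported functions under $\left(\int(|\nabla u|_p^p+|u|^p)d\mu\right)^{1/p}$; the working space is $X=W^{1,p}(\mathbb{Z}^N)$ with the norm $\left(\int(|\nabla u|_p^p+(V+1)|u|^p)d\mu\right)^{1/p}$. The energy $J:X\to(-\infty,+\infty]$ is $$J(u)=\frac1p\int_{\mathbb{Z}^N}\left(|\nabla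 u|_p^p+(V(x)+1)|u|^p\right)d\mu-\frac1p\int_{\mathbb{Z}^N}|u|^p\log|u|^p\,d\mu$$ with $0\log0=0$; $D(J)=\{u\in X:J(u)<+\infty\}$. The Nehari manifold is $$\mathcal{N}=\left\{u\in D(J)\setminus\{0\}:\int_{\mathbb{Z}^N}(|\nabla u|_p^p+V|u|^p)\,d\mu=\int_{\mathbb{Z}^N}|u|^p\log|u|^p\,d\mu\right\}.$$ A solution is $u\in D(J)$ satisfying the equation at every vertex; a ground state solution is a nontrivial solution $u$ with $J(u)=\inf_{\mathcal{N}}J$. *)

theory Defs
  imports "HOL-Analysis.Analysis"
begin

text \<open>The lattice graph $\mathbb{Z}^N$ has vertex type \<^typ>\<open>int ^ 'n\<close>, where $N$ is the
  cardinality of the finite index type \<^typ>\<open>'n\<close> (so $N$ is arbitrary and at least 1).\<close>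

definition lattice_norm :: "int ^ 'n \<Rightarrow> int" where
  "lattice_norm x = (\<Sum>i\<in>UNIV. \<bar>x $ i\<bar>)"

definition nbrs :: "int ^ 'n \<Rightarrow> (int ^ 'n) set" where
  "nbrs x = {y. lattice_norm (x - y) = 1}"

definition sgn_powr :: "real \<Rightarrow> real \<Rightarrow> real" where
  "sgn_powr q t = \<bar>t\<bar> powr q * t"

definition p_laplacian :: "real \<Rightarrow> (int ^ 'n \<Rightarrow> real) \<Rightarrow> int ^ 'n \<Rightarrow> real" where
  "p_laplacian p u x = (\<Sum>y\<in>nbrs x. sgn_powr (p - 2) (u y - u x))"

definition grad_norm :: "real \<Rightarrow> (int ^ 'n \<Rightarrow> real) \<Rightarrow> int ^ 'n \<Rightarrow> real" where
  "grad_norm p u x = ((1/2) * (\<Sum>y\<in>nbrs x. \<bar>u y - u x\<bar> powr p)) powr (1/p)"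

definition sobolev_density :: "real \<Rightarrow> (int ^ 'n \<Rightarrow> real) \<Rightarrow> int ^ 'n \<Rightarrow> real" where
  "sobolev_density p u x = grad_norm p u x powr p + \<bar>u x\<bar> powr p"

definition sobolev_norm :: "real \<Rightarrow> (int ^ 'n \<Rightarrow> real) \<Rightarrow> real" where
  "sobolev_norm p u = (LINT x|count_space UNIV. sobolev_density p u x) powr (1/p)"

text \<open>The completion of the finitely supported functions, realized as a space of functions:
  the norm dominates point evaluations, so a Cauchy sequence of finitely supported functions
  converges pointwise, and (by Fatou) in norm, to a unique function of finite norm. Functions of
  finite norm form a vector space containing the finitely supported ones, so the Bochner
  integral in \<^term>\<open>sobolev_norm p (\<lambda>x. u x - \<phi> k x)\<close> below never takes its
  default value.\<close>

definition W1p :: "real \<Rightarrow> (int ^ 'n \<Rightarrow> real) set" where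
  "W1p p = {u. integrable (count_space UNIV) (sobolev_density p u) \<and>
     (\<exists>\<phi> :: nat \<Rightarrow> int ^ 'n \<Rightarrow> real. (\<forall>k. finite {x. \<phi> k x \<noteq> 0}) \<and>
        (\<lambda>k. sobolev_norm p (\<lambda>x. u x - \<phi> k x)) \<longlonglongrightarrow> 0)}"

text \<open>The integral with respect to counting measure with values in the extended reals. It is the
  usual one as soon as the positive or the negative part has finite integral. This is always the
  case below for functions in \<^const>\<open>W1p\<close> and bounded $V$: such functions tend to zero at
  infinity, so $|u|^p\log|u|^p$ is positive at only finitely many vertices.\<close>

definition ext_integral :: "(int ^ 'n \<Rightarrow> real) \<Rightarrow> ereal" where
  "ext_integral f = enn2ereal (\<integral>\<^sup>+x. ennreal (f x) \<partial>count_space UNIV)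
                  - enn2ereal (\<integral>\<^sup>+x. ennreal (- f x) \<partial>count_space UNIV)"

text \<open>The convention $0\log 0=0$ holds since \<^term>\<open>(0::real) powr p = 0\<close>.\<close>

definition log_integral :: "real \<Rightarrow> (int ^ 'n \<Rightarrow> real) \<Rightarrow> ereal" where
  "log_integral p u = ext_integral (\<lambda>x. \<bar>u x\<bar> powr p * ln (\<bar>u x\<bar> powr p))"

definition energy :: "real \<Rightarrow> (int ^ 'n \<Rightarrow> real) \<Rightarrow> (int ^ 'n \<Rightarrow> real) \<Rightarrow> ereal" where
  "energy p V u =
     ereal (1/p) * ext_integral (\<lambda>x. grad_norm p u x powr p + (V x + 1) * \<bar>u x\<bar> powr p)
     - ereal (1/p) * log_integral p u"

definition energy_dom :: "real \<Rightarrow> (int ^ 'n \<Rightarrow> real) \<Rightarrow> (int ^ 'n \<Rightarrow> real) set" where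
  "energy_dom p V = {u \<in> W1p p. energy p V u < \<infinity>}"

definition nehari :: "real \<Rightarrow> (int ^ 'n \<Rightarrow> real) \<Rightarrow> (int ^ 'n \<Rightarrow> real) set" where
  "nehari p V = {u \<in> energy_dom p V - {\<lambda>x. 0}.
     ext_integral (\<lambda>x. grad_norm p u x powr p + V x * \<bar>u x\<bar> powr p) = log_integral p u}"

definition is_solution :: "real \<Rightarrow> (int ^ 'n \<Rightarrow> real) \<Rightarrow> (int ^ 'n \<Rightarrow> real) \<Rightarrow> bool" where
  "is_solution p V u \<longleftrightarrow> u \<in> energy_dom p V \<and>
     (\<forall>x. - p_laplacian p u x + V x * sgn_powr (p - 2) (u x)
          = sgn_powr (p - 2) (u x) * ln (\<bar>u x\<bar> powr p))"

definition is_ground_state :: "real \<Rightarrow> (int ^ 'n \<Rightarrow> real) \<Rightarrow> (int ^ 'n \<Rightarrow> real) \<Rightarrow> bool" where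
  "is_ground_state p V u \<longleftrightarrow> is_solution p V u \<and> u \<noteq> (\<lambda>x. 0) \<and>
     energy p V u = (INF v\<in>nehari p V. energy p V v)"

end

theory Submission
  imports Defs
begin

text \<open>Write $F(u)=\sum(|\nabla u|_p^p+V|u|^p-|u|^p\log|u|^p)$ for the \<open>action\<close> and
  $m(u)=\sum|u|^p$ for the \<open>mass\<close>. On \<open>energy_dom p V\<close> both are finite, the energy is
  $(F+m)/p$, and the Nehari manifold is $\{u\neq 0: F(u)=0\}$, where the energy is $m/p$. Since
  $F(tu)=t^p(F(u)-\log t^p\,m(u))$, every ray meets the Nehari manifold exactly once, so that
  minimizing the energy on it is the same as minimizing $F$ on the sphere $m=1$: if $I$ is the
  infimum of $F$ there, then $F(v)\ge m(v)(I-\log m(v))$ for every $v$, hence $m(v)\ge e^I$ on the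
  Nehari manifold, and a minimizer $w$ on the sphere becomes the ground state $e^{I/p}w$.

  On the sphere $|u|^p$ is a probability distribution and $-\sum|u|^p\log|u|^p\ge 0$ is its
  Shannon entropy. This gives compactness in two ways. An entropy bound prevents vanishing: some
  vertex carries a mass bounded from below along a minimizing sequence. Dichotomy is excluded as
  well, without comparing energy levels: splitting off a fraction $s$ of the mass costs
  $-s\log s-(1-s)\log(1-s)>0$, because $t\mapsto t(I-\log t)$ bounds $F$ on each piece. So after
  translating the heavy vertices to the origin, a pointwise limit of a subsequence keeps the whole
  mass, and Fatou's lemma bounds its action by $I$ (lemma \<open>minimizing_sequence_limit\<close>).

  The translated potentials converge either to a translate of $V$ or to the constant $V_\infty$. In
  the second case $V\le V_\infty$ shows that the same limit function has $F$ at most $I$ for $V$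
  itself, so in either case $F$ attains its infimum (lemma \<open>action_minimizer_exists\<close>).

  Replacing $w$ by $|w|$ does not increase $F$. Changing the value at a single vertex changes only
  finitely many terms of $F$; since $p>1$ the result is differentiable also where $w$
  vanishes, and this yields the Euler--Lagrange equation vertex by vertex. At a zero of $w\ge 0$ the
  equation forces all neighbours to vanish, hence $w=0$ by connectedness. So $w>0$
  everywhere.\<close>

section \<open>The action functional and its domain\<close>

definition unit_steps :: "(int ^ 'n) set" where
  "unit_steps = {e. lattice_norm e = 1}"

text \<open>The $p$-th power of $|\nabla u(x)|_p$, summed over steps instead of neighbours, so that
  translating a function amounts to reindexing.\<close>

definition grad_density :: "real \<Rightarrow> (int ^ 'n \<Rightarrow> real) \<Rightarrow> int ^ 'n \<Rightarrow> real" where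
  "grad_density p u x = (1/2) * (\<Sum>e\<in>unit_steps. \<bar>u (x + e) - u x\<bar> powr p)"

definition lp_summable :: "real \<Rightarrow> (int ^ 'n \<Rightarrow> real) \<Rightarrow> bool" where
  "lp_summable p u \<longleftrightarrow> (\<lambda>x. \<bar>u x\<bar> powr p) summable_on UNIV"

definition mass :: "real \<Rightarrow> (int ^ 'n \<Rightarrow> real) \<Rightarrow> real" where
  "mass p u = (\<Sum>\<^sub>\<infinity>x. \<bar>u x\<bar> powr p)"

definition log_term :: "real \<Rightarrow> real \<Rightarrow> real" where
  "log_term p t = \<bar>t\<bar> powr p * ln (\<bar>t\<bar> powr p)"

definition admissible :: "real \<Rightarrow> (int ^ 'n \<Rightarrow> real) \<Rightarrow> bool" where
  "admissible p u \<longleftrightarrow> lp_summable p u \<and> (\<lambda>x. log_term p (u x)) summable_on UNIV"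

definition action_density ::
    "real \<Rightarrow> (int ^ 'n \<Rightarrow> real) \<Rightarrow> (int ^ 'n \<Rightarrow> real) \<Rightarrow> int ^ 'n \<Rightarrow> real" where
  "action_density p V u x = grad_density p u x + V x * \<bar>u x\<bar> powr p - log_term p (u x)"

text \<open>Its nonzero admissible zeros form the Nehari manifold.\<close>

definition action :: "real \<Rightarrow> (int ^ 'n \<Rightarrow> real) \<Rightarrow> (int ^ 'n \<Rightarrow> real) \<Rightarrow> real" where
  "action p V u = (\<Sum>\<^sub>\<infinity>x. action_density p V u x)"

section \<open>Unconditional sums of real functions\<close>

lemma summable_on_if_abs_le:
  fixes f g :: "'a \<Rightarrow> real"
  assumes "g summable_on A" "\<And>x. x \<in> A \<Longrightarrow> \<bar>f x\<bar> \<le> g x"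
  shows "f summable_on A"
  using Infinite_Sum.abs_summable_on_comparison_test'[of g A f] assms
  by (simp add: abs_summable_summable)

lemma summable_on_diff_real:
  fixes f g :: "'a \<Rightarrow> real"
  assumes "f summable_on A" "g summable_on A"
  shows "(\<lambda>x. f x - g x) summable_on A"
  using summable_on_add[OF assms(1) summable_on_uminus[THEN iffD2, OF assms(2)]] by simp

lemma infsum_diff_real:
  fixes f g :: "'a \<Rightarrow> real"
  assumes "f summable_on A" "g summable_on A"
  shows "infsum (\<lambda>x. f x - g x) A = infsum f A - infsum g A"
  using infsum_add[OF assms(1) summable_on_uminus[THEN iffD2, OF assms(2)]]
  by (simp add: infsum_uminus)

lemma finite_support_has_sum:
  fixes f :: "'a \<Rightarrow> real"
  assumes "finite B" "\<And>x. x \<notin> B \<Longrightarrow> f x = 0"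
  shows "(f has_sum (\<Sum>x\<in>B. f x)) UNIV"
  using assms by (intro has_sum_finite_neutralI[of B]) auto

lemma finite_change:
  fixes f g :: "'a \<Rightarrow> real"
  assumes "f summable_on UNIV" "finite B" "\<And>x. x \<notin> B \<Longrightarrow> g x = f x"
  shows "g summable_on UNIV" "infsum g UNIV = infsum f UNIV + (\<Sum>x\<in>B. g x - f x)"
proof -
  have "((\<lambda>x. g x - f x) has_sum (\<Sum>x\<in>B. g x - f x)) UNIV"
    using assms by (intro finite_support_has_sum) auto
  from has_sum_add[OF has_sum_infsum[OF assms(1)] this]
  have "(g has_sum (infsum f UNIV + (\<Sum>x\<in>B. g x - f x))) UNIV" by simp
  then show "g summable_on UNIV" "infsum g UNIV = infsum f UNIV + (\<Sum>x\<in>B. g x - f x)"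
    by (auto simp: has_sum_iff)
qed

text \<open>Fatou's lemma for counting measure: only finite partial sums have to be passed to the limit.\<close>

lemma fatou_infsum:
  fixes f :: "nat \<Rightarrow> 'a \<Rightarrow> real"
  assumes sm: "\<And>n. f n summable_on UNIV" and nn: "\<And>n x. 0 \<le> f n x"
    and le: "\<And>n. infsum (f n) UNIV \<le> C n" and C: "C \<longlonglongrightarrow> L"
    and lim: "\<And>x. (\<lambda>n. f n x) \<longlonglongrightarrow> g x"
  shows "g summable_on UNIV" "infsum g UNIV \<le> L"
proof -
  have nng: "0 \<le> g x" for x
    using LIMSEQ_le_const[OF lim] nn by blast
  have fin: "sum g B \<le> L" if "finite B" for B
  proof (rule LIMSEQ_le[OF tendsto_sum[OF lim] C])
    show "\<exists>N. \<forall>n\<ge>N. (\<Sum>x\<in>B. f n x) \<le> C n"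
      using finite_sum_le_infsum[OF sm that] nn le order_trans by (metis subset_UNIV)
  qed
  show "g summable_on UNIV"
    by (rule nonneg_bdd_above_summable_on) (auto simp: nng intro!: bdd_aboveI2 fin)
  then show "infsum g UNIV \<le> L"
    by (rule infsum_le_finite_sums) (auto intro: fin)
qed

lemma finite_sum_exhausts_infsum:
  fixes f :: "'a \<Rightarrow> real"
  assumes "f summable_on UNIV" "\<And>x. 0 \<le> f x" "e > 0"
  obtains B where "finite B" "infsum f UNIV - e < sum f B"
proof -
  have "\<exists>B. finite B \<and> infsum f UNIV - e < sum f B"
  proof (rule ccontr)
    assume "\<not> ?thesis"
    then have "infsum f UNIV \<le> infsum f UNIV - e"
      by (intro infsum_le_finite_sums[OF assms(1)]) (auto simp: not_less)
    then show False using assms(3) by simp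
  qed
  then show ?thesis using that by blast
qed

section \<open>Steps and translations of the lattice\<close>

lemma nbrs_eq: "nbrs x = (+) x ` unit_steps"
proof -
  have s: "lattice_norm (- z) = lattice_norm z" for z :: "int ^ 'a"
    by (simp add: lattice_norm_def)
  show ?thesis
  proof (intro set_eqI iffI)
    fix y assume "y \<in> nbrs x"
    then have "y - x \<in> unit_steps" using s[of "x - y"] by (simp add: nbrs_def unit_steps_def)
    then show "y \<in> (+) x ` unit_steps" by (intro image_eqI[of _ _ "y - x"]) auto
  next
    fix y assume "y \<in> (+) x ` unit_steps"
    then show "y \<in> nbrs x" using s by (auto simp: nbrs_def unit_steps_def)
  qed
qed

lemma sum_nbrs: "(\<Sum>y\<in>nbrs x. f y) = (\<Sum>e\<in>unit_steps. f (x + e))"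
  unfolding nbrs_eq by (subst sum.reindex) (auto simp: inj_on_def)

lemma uminus_unit_steps [simp]: "- e \<in> unit_steps \<longleftrightarrow> e \<in> unit_steps"
  by (simp add: unit_steps_def lattice_norm_def)

lemma abs_nth_le_lattice_norm: "\<bar>x $ i\<bar> \<le> lattice_norm x"
  unfolding lattice_norm_def by (rule member_le_sum) auto

lemma finite_lattice_ball: "finite {x :: int ^ 'n. lattice_norm x \<le> r}"
proof -
  have "finite (PiE (UNIV :: 'n set) (\<lambda>_. {-r..r}))" by (intro finite_PiE) auto
  moreover have "{x :: int ^ 'n. lattice_norm x \<le> r} \<subseteq> vec_lambda ` (PiE (UNIV :: 'n set) (\<lambda>_. {-r..r}))"
  proof
    fix x :: "int ^ 'n" assume "x \<in> {x. lattice_norm x \<le> r}"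
    then have "\<bar>x $ i\<bar> \<le> r" for i using abs_nth_le_lattice_norm[of x i] by simp
    then have "vec_nth x \<in> PiE (UNIV :: 'n set) (\<lambda>_. {-r..r})"
      by (auto simp: PiE_def abs_le_iff minus_le_iff)
    then show "x \<in> vec_lambda ` (PiE (UNIV :: 'n set) (\<lambda>_. {-r..r}))"
      by (intro image_eqI[of _ _ "vec_nth x"]) auto
  qed
  ultimately show ?thesis using finite_surj by blast
qed

lemma finite_unit_steps [simp]: "finite (unit_steps :: (int ^ 'n) set)"
  by (rule finite_subset[OF _ finite_lattice_ball[of 1]]) (auto simp: unit_steps_def)

lemma sum_unit_steps_uminus: "(\<Sum>e\<in>unit_steps. f (- e)) = (\<Sum>e\<in>unit_steps. f e)"
  by (rule sum.reindex_bij_witness[of _ uminus uminus]) auto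

text \<open>Connectedness of the lattice graph as an induction rule. One moves towards the target along a
  coordinate in which it is not yet reached, which lowers the distance by one.\<close>

lemma neighbour_step_induct [consumes 1, case_names step]:
  fixes P :: "int ^ 'n \<Rightarrow> bool"
  assumes "P z" and step: "\<And>x e. P x \<Longrightarrow> e \<in> unit_steps \<Longrightarrow> P (x + e)"
  shows "P x"
proof -
  have "P (z + y)" for y
  proof (induction "nat (lattice_norm y)" arbitrary: y)
    case 0
    then have "lattice_norm y \<le> 0" by simp
    then have "y $ i = 0" for i using abs_nth_le_lattice_norm[of y i] by simp
    then have "y = 0" by (simp add: vec_eq_iff)
    then show ?case using assms(1) by simp
  next
    case (Suc k)
    have "\<exists>i. y $ i \<noteq> 0"
    proof (rule ccontr)
      assume "\<not> ?thesis" then show False using Suc(2) by (simp add: lattice_norm_def)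
    qed
    then obtain i where i: "y $ i \<noteq> 0" by blast
    define e :: "int ^ 'n" where "e = axis i (sgn (y $ i))"
    have nth_e: "e $ j = (if j = i then sgn (y $ i) else 0)" for j
      by (simp add: e_def axis_def)
    have "lattice_norm e = 1"
      using i by (simp add: lattice_norm_def nth_e abs_sgn_eq if_distrib[of abs] cong: if_cong)
    then have e: "e \<in> unit_steps" by (simp add: unit_steps_def)
    have "lattice_norm (y - e) = (\<Sum>j\<in>UNIV. \<bar>y $ j\<bar> - (if j = i then 1 else 0))"
      unfolding lattice_norm_def using i
      by (intro sum.cong refl) (auto simp: nth_e sgn_if)
    also have "\<dots> = lattice_norm y - 1" by (simp add: sum_subtractf lattice_norm_def)
    finally have "nat (lattice_norm (y - e)) = k" using Suc(2) by simp
    then have "P (z + (y - e))" using Suc(1) by simp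
    from step[OF this e] show ?case by (simp add: algebra_simps)
  qed
  from this[of "x - z"] show ?thesis by simp
qed

lemma has_sum_finite_sum:
  fixes f :: "'b \<Rightarrow> 'a \<Rightarrow> real"
  assumes "finite B" "\<And>i. i \<in> B \<Longrightarrow> (f i has_sum s i) A"
  shows "((\<lambda>x. \<Sum>i\<in>B. f i x) has_sum (\<Sum>i\<in>B. s i)) A"
  using assms by (induction B rule: finite_induct) (auto intro!: has_sum_add)

lemma bij_translate: "bij (\<lambda>x :: int ^ 'n. x + a)"
  by (rule bij_betw_byWitness[of _ "\<lambda>x. x - a"]) auto

lemma summable_on_translate:
  fixes f :: "int ^ 'n \<Rightarrow> real"
  shows "(\<lambda>x. f (x + a)) summable_on UNIV \<longleftrightarrow> f summable_on UNIV"
  using summable_on_reindex_bij_betw[OF bij_translate] .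

lemma infsum_translate:
  fixes f :: "int ^ 'n \<Rightarrow> real"
  shows "(\<Sum>\<^sub>\<infinity>x. f (x + a)) = (\<Sum>\<^sub>\<infinity>x. f x)"
  using infsum_reindex_bij_betw[OF bij_translate] .

text \<open>Each vertex is an end of one edge per step, and the factor $1/2$ compensates for
  counting every edge from both of its ends.\<close>

lemma has_sum_steps:
  fixes f :: "int ^ 'n \<Rightarrow> real"
  assumes "f summable_on UNIV"
  shows "((\<lambda>x. (1/2) * (\<Sum>e\<in>unit_steps. f x + f (x + e))) has_sum
      (real (card (unit_steps :: (int ^ 'n) set)) * infsum f UNIV)) UNIV"
proof -
  have "((\<lambda>x. f (x + e)) has_sum infsum f UNIV) UNIV" for e
    using assms summable_on_translate[of f e] infsum_translate[of f e] by (simp add: has_sum_iff)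
  then have "((\<lambda>x. \<Sum>e\<in>unit_steps. f x + f (x + e)) has_sum
      (\<Sum>e\<in>(unit_steps :: (int ^ 'n) set). infsum f UNIV + infsum f UNIV)) UNIV"
    using assms by (intro has_sum_finite_sum has_sum_add) auto
  from has_sum_cmult_right[OF this, of "1/2"] show ?thesis by (simp add: algebra_simps)
qed

section \<open>Gradient bounds, summability and scaling\<close>

lemma abs_diff_powr_le:
  fixes a b p :: real
  assumes "p > 0"
  shows "\<bar>a - b\<bar> powr p \<le> 2 powr p * (\<bar>a\<bar> powr p + \<bar>b\<bar> powr p)"
proof -
  have "\<bar>a - b\<bar> powr p \<le> (2 * max \<bar>a\<bar> \<bar>b\<bar>) powr p"
    using assms by (intro powr_mono2) auto
  also have "\<dots> = 2 powr p * max \<bar>a\<bar> \<bar>b\<bar> powr p" by (simp add: powr_mult)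
  also have "\<dots> \<le> 2 powr p * (\<bar>a\<bar> powr p + \<bar>b\<bar> powr p)"
    by (intro mult_left_mono) (auto simp: max_def)
  finally show ?thesis .
qed

lemma grad_density_nonneg: "0 \<le> grad_density p u x"
  by (simp add: grad_density_def sum_nonneg)

lemma grad_density_le:
  assumes "p > 0"
  shows "grad_density p u x \<le> 2 powr p * ((1/2) * (\<Sum>e\<in>unit_steps. \<bar>u x\<bar> powr p + \<bar>u (x + e)\<bar> powr p))"
proof -
  have "(\<Sum>e\<in>unit_steps. \<bar>u (x + e) - u x\<bar> powr p)
      \<le> (\<Sum>e\<in>unit_steps. 2 powr p * (\<bar>u x\<bar> powr p + \<bar>u (x + e)\<bar> powr p))"
    using abs_diff_powr_le[OF assms] by (intro sum_mono) (metis add.commute)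
  then show ?thesis by (simp add: grad_density_def sum_distrib_left[symmetric] mult.assoc)
qed

text \<open>Since every vertex has the same finite degree, the gradient is controlled by the function
  itself; hence the Sobolev space is just $\ell^p$.\<close>

lemma grad_density_summable:
  assumes "p > 0" "lp_summable p u"
  shows "grad_density p u summable_on UNIV"
    and "infsum (grad_density p u) UNIV
      \<le> 2 powr p * real (card (unit_steps :: (int ^ 'n) set)) * mass p (u :: int ^ 'n \<Rightarrow> real)"
proof -
  have *: "((\<lambda>x. 2 powr p * ((1/2) * (\<Sum>e\<in>unit_steps. \<bar>u x\<bar> powr p + \<bar>u (x + e)\<bar> powr p))) has_sum
     2 powr p * (real (card (unit_steps :: (int ^ 'n) set)) * mass p u)) UNIV"
    using assms(2) unfolding mass_def
    by (intro has_sum_cmult_right has_sum_steps) (simp add: lp_summable_def)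
  show sm: "grad_density p u summable_on UNIV"
    by (rule summable_on_comparison_test[OF has_sum_imp_summable[OF *]])
      (use grad_density_le[OF assms(1), of u] in \<open>simp_all add: grad_density_nonneg\<close>)
  show "infsum (grad_density p u) UNIV
      \<le> 2 powr p * real (card (unit_steps :: (int ^ 'n) set)) * mass p u"
    using has_sum_mono[OF has_sum_infsum[OF sm] *] grad_density_le[OF assms(1), of u]
    by (simp add: mult.assoc)
qed

lemma log_term_0 [simp]: "log_term p 0 = 0"
  by (simp add: log_term_def)

lemma log_term_abs [simp]: "log_term p \<bar>t\<bar> = log_term p t"
  by (simp add: log_term_def)

lemma log_term_scale:
  assumes "t > 0"
  shows "log_term p (t * s) = t powr p * (log_term p s + p * ln t * \<bar>s\<bar> powr p)"
  using assms by (cases "s = 0") (auto simp: log_term_def abs_mult powr_mult ln_mult ln_powr algebra_simps)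

lemma admissibleD:
  assumes "admissible p u"
  shows "lp_summable p u" "(\<lambda>x. \<bar>u x\<bar> powr p) summable_on UNIV"
    "(\<lambda>x. log_term p (u x)) summable_on UNIV"
  using assms by (auto simp: admissible_def lp_summable_def)

lemma potential_term_summable:
  fixes V u :: "int ^ 'n \<Rightarrow> real"
  assumes "\<And>x. \<bar>V x\<bar> \<le> K" "lp_summable p u"
  shows "(\<lambda>x. V x * \<bar>u x\<bar> powr p) summable_on UNIV"
  by (rule summable_on_if_abs_le[where g="\<lambda>x. K * \<bar>u x\<bar> powr p"])
    (use assms in \<open>auto simp: lp_summable_def abs_mult intro!: summable_on_cmult_right mult_right_mono\<close>)

lemma action_density_summable:
  assumes "p > 0" "\<And>x. \<bar>V x\<bar> \<le> K" "admissible p u"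
  shows "action_density p V u summable_on UNIV"
  unfolding action_density_def[abs_def]
  using grad_density_summable(1)[OF assms(1) admissibleD(1)[OF assms(3)]]
    potential_term_summable[of V, OF assms(2) admissibleD(1)[OF assms(3)]] admissibleD(3)[OF assms(3)]
  by (intro summable_on_diff_real summable_on_add)

lemma mass_nonneg: "0 \<le> mass p u"
  by (simp add: mass_def infsum_nonneg)

lemma mass_eq_0_iff:
  assumes "lp_summable p u"
  shows "mass p u = 0 \<longleftrightarrow> u = (\<lambda>x. 0)"
proof
  assume "mass p u = 0"
  then have "\<bar>u x\<bar> powr p = 0" for x
    using nonneg_infsum_le_0D[of "\<lambda>x. \<bar>u x\<bar> powr p" UNIV x] assms
    by (simp add: mass_def lp_summable_def)
  then show "u = (\<lambda>x. 0)" by auto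
qed (simp add: mass_def)

lemma action_0 [simp]: "action p V (\<lambda>x. 0) = 0"
  by (simp add: action_def action_density_def grad_density_def)

lemma admissible_scale:
  assumes "t > 0" "admissible p u"
  shows "admissible p (\<lambda>x. t * u x)"
  unfolding admissible_def lp_summable_def
proof
  show "(\<lambda>x. \<bar>t * u x\<bar> powr p) summable_on UNIV"
    using admissibleD(2)[OF assms(2)] assms(1)
    by (simp add: abs_mult powr_mult summable_on_cmult_right)
  show "(\<lambda>x. log_term p (t * u x)) summable_on UNIV"
    unfolding log_term_scale[OF assms(1)]
    using admissibleD[OF assms(2)] by (intro summable_on_cmult_right summable_on_add)
qed

lemma mass_scale:
  assumes "t > 0"
  shows "mass p (\<lambda>x. t * u x) = t powr p * mass p u"
  using assms by (simp add: mass_def abs_mult powr_mult infsum_cmult_right')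

lemma action_density_scale:
  assumes "t > 0"
  shows "action_density p V (\<lambda>x. t * u x) x
    = t powr p * (action_density p V u x - p * ln t * \<bar>u x\<bar> powr p)"
proof -
  have "\<bar>t * a - t * b\<bar> powr p = t powr p * \<bar>a - b\<bar> powr p" for a b
    using assms by (simp add: right_diff_distrib[symmetric] abs_mult powr_mult)
  then have "grad_density p (\<lambda>x. t * u x) x = t powr p * grad_density p u x"
    by (simp add: grad_density_def sum_distrib_left[symmetric])
  then show ?thesis
    using assms by (simp add: action_density_def log_term_scale abs_mult powr_mult algebra_simps)
qed

text \<open>The logarithm makes the action homogeneous only up to a term that is linear in the mass;
  this term is what places exactly one point of each ray on the Nehari manifold.\<close>

lemma action_scale:
  assumes "p > 0" "\<And>x. \<bar>V x\<bar> \<le> K" "t > 0" "admissible p u"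
  shows "action p V (\<lambda>x. t * u x) = t powr p * (action p V u - p * ln t * mass p u)"
  unfolding action_def action_density_scale[OF assms(3)] infsum_cmult_right'
  using action_density_summable[of p V, OF assms(1,2,4)] admissibleD(2)[OF assms(4)]
  by (subst infsum_diff_real) (auto simp: mass_def infsum_cmult_right' intro: summable_on_cmult_right)

text \<open>A lower bound on the unit sphere spreads to all functions by scaling with $t = m^{-1/p}$.
  The statement includes the zero function because \<open>ln 0\<close> is multiplied by zero.\<close>

lemma action_ge_of_unit_mass_bound:
  assumes "p > 0" "\<And>x. \<bar>V x\<bar> \<le> K" "admissible p u"
    and I: "\<And>v. admissible p v \<Longrightarrow> mass p v = 1 \<Longrightarrow> I \<le> action p V v"
  shows "mass p u * (I - ln (mass p u)) \<le> action p V u"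
proof (cases "mass p u = 0")
  case True
  then show ?thesis using mass_eq_0_iff[OF admissibleD(1)[OF assms(3)]] by simp
next
  case False
  define m where "m = mass p u"
  have m: "m > 0" using False mass_nonneg[of p u] by (simp add: m_def)
  define t where "t = m powr (- 1 / p)"
  have t: "t > 0" using m by (simp add: t_def)
  have "t powr p = m powr - 1" unfolding t_def powr_powr using assms(1) by simp
  then have tp: "t powr p = 1 / m" using m by (simp add: powr_minus_divide)
  have lnt: "p * ln t = - ln m" using assms(1) m by (simp add: t_def ln_powr)
  have "I \<le> action p V (\<lambda>x. t * u x)"
    by (rule I[OF admissible_scale[OF t assms(3)]]) (use m in \<open>simp add: mass_scale[OF t] tp m_def\<close>)
  also have "\<dots> = (action p V u + ln m * m) / m"
    unfolding action_scale[of p V, OF assms(1,2) t assms(3)] tp lnt by (simp add: m_def)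
  finally show ?thesis using m unfolding m_def[symmetric] by (simp add: field_simps)
qed

text \<open>Small values make the entropy large: $-\log|u|^p\ge-\log d$ wherever $|u|^p\le d$. Read
  contrapositively, a function of bounded action is not small everywhere, which excludes vanishing.
  With $d = 1$ it bounds the action on the unit sphere from below.\<close>

lemma action_ge_if_small:
  assumes "p > 0" "\<And>x. \<bar>V x\<bar> \<le> K" "\<And>x. a \<le> V x" "admissible p u"
    and d: "d > 0" "\<And>x. \<bar>u x\<bar> powr p \<le> d"
  shows "(a - ln d) * mass p u \<le> action p V u"
proof -
  have "(a - ln d) * \<bar>u x\<bar> powr p \<le> action_density p V u x" for x
  proof -
    have "log_term p (u x) \<le> ln d * \<bar>u x\<bar> powr p"
    proof (cases "u x = 0")
      case False
      then have "ln (\<bar>u x\<bar> powr p) \<le> ln d" using d by (subst ln_le_cancel_iff) auto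
      then show ?thesis unfolding log_term_def by (subst mult.commute) (intro mult_right_mono, auto)
    qed simp
    moreover have "a * \<bar>u x\<bar> powr p \<le> V x * \<bar>u x\<bar> powr p"
      using assms(3) by (intro mult_right_mono) auto
    ultimately show ?thesis using grad_density_nonneg[of p u x]
      by (simp add: action_density_def algebra_simps)
  qed
  then have "(\<Sum>\<^sub>\<infinity>x. (a - ln d) * \<bar>u x\<bar> powr p) \<le> action p V u"
    unfolding action_def
    using action_density_summable[of p V, OF assms(1,2,4)] admissibleD(2)[OF assms(4)]
    by (intro infsum_mono summable_on_cmult_right) auto
  then show ?thesis by (simp add: mass_def infsum_cmult_right')
qed

section \<open>Cutting a function into two pieces\<close>

definition restr :: "'a set \<Rightarrow> ('a \<Rightarrow> real) \<Rightarrow> 'a \<Rightarrow> real" where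
  "restr B u x = (if x \<in> B then u x else 0)"

lemma lp_summable_restr:
  assumes "lp_summable p u"
  shows "lp_summable p (restr B u)"
  unfolding lp_summable_def
  by (rule summable_on_if_abs_le[OF assms[unfolded lp_summable_def]]) (simp add: restr_def)

lemma admissible_restr:
  assumes "admissible p u"
  shows "admissible p (restr B u)"
  unfolding admissible_def
proof
  show "lp_summable p (restr B u)" by (rule lp_summable_restr[OF admissibleD(1)[OF assms]])
  have "(\<lambda>x. \<bar>log_term p (u x)\<bar>) summable_on UNIV"
    using admissibleD(3)[OF assms] summable_on_iff_abs_summable_on_real by force
  then show "(\<lambda>x. log_term p (restr B u x)) summable_on UNIV"
    by (rule summable_on_if_abs_le) (simp add: restr_def)
qed

lemma mass_restr_finite:
  assumes "finite B"
  shows "mass p (restr B u) = (\<Sum>x\<in>B. \<bar>u x\<bar> powr p)"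
  using finite_support_has_sum[of B "\<lambda>x. \<bar>restr B u x\<bar> powr p"] assms
  by (simp add: mass_def has_sum_iff restr_def cong: sum.cong)

lemma mass_restr_compl:
  assumes "lp_summable p u"
  shows "mass p (restr (- B) u) = mass p u - mass p (restr B u)"
  unfolding mass_def
  by (subst infsum_diff_real[symmetric])
    (use assms lp_summable_restr[OF assms, of B] in \<open>auto simp: lp_summable_def restr_def intro!: infsum_cong\<close>)

text \<open>The potential and logarithmic terms split exactly over functions with disjoint supports; only
  the edges joining \<open>B\<close> to its complement matter. Such an edge contributes
  $|u(x)|^p+|u(y)|^p$ to the two pieces together, and this is paid for by the mass near the
  boundary of \<open>B\<close>, represented by the finite set \<open>C\<close>.\<close>

lemma action_cut:
  fixes u V :: "int ^ 'n \<Rightarrow> real"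
  assumes p: "p > 0" and V: "\<And>x. \<bar>V x\<bar> \<le> K" and adm: "admissible p u"
    and B: "finite C" "\<And>x e. e \<in> unit_steps \<Longrightarrow> x \<in> B \<Longrightarrow> x + e \<notin> B \<Longrightarrow> x \<in> C \<and> x + e \<in> C"
  shows "action p V (restr B u) + action p V (restr (- B) u)
      - real (card (unit_steps :: (int ^ 'n) set)) * (\<Sum>x\<in>C. \<bar>u x\<bar> powr p) \<le> action p V u"
proof -
  define h where "h x = \<bar>restr C u x\<bar> powr p" for x
  have h: "(h has_sum (\<Sum>x\<in>C. \<bar>u x\<bar> powr p)) UNIV"
    using finite_support_has_sum[of C h] B(1) by (simp add: h_def restr_def cong: sum.cong)
  have hs: "((\<lambda>x. (1/2) * (\<Sum>e\<in>unit_steps. h x + h (x + e))) has_sum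
      (real (card (unit_steps :: (int ^ 'n) set)) * (\<Sum>x\<in>C. \<bar>u x\<bar> powr p))) UNIV"
    using has_sum_steps[OF has_sum_imp_summable[OF h]] h by (simp add: has_sum_iff)
  have edge: "\<bar>restr B u (x + e) - restr B u x\<bar> powr p + \<bar>restr (-B) u (x + e) - restr (-B) u x\<bar> powr p
      \<le> \<bar>u (x + e) - u x\<bar> powr p + (h x + h (x + e))" if e: "e \<in> unit_steps" for x e
  proof -
    have hp: "0 \<le> h x" "0 \<le> h (x + e)" by (auto simp: h_def)
    consider "x \<in> B \<longleftrightarrow> x + e \<in> B" | "x \<in> B" "x + e \<notin> B" | "x \<notin> B" "x + e \<in> B" by blast
    then show ?thesis
    proof cases
      case 1 then show ?thesis using hp by (auto simp: restr_def)
    next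
      case 2
      then show ?thesis using B(2)[OF e, of x] by (simp add: restr_def h_def)
    next
      case 3
      then show ?thesis using B(2)[of "- e" "x + e"] e by (simp add: restr_def h_def)
    qed
  qed
  have dens: "action_density p V (restr B u) x + action_density p V (restr (- B) u) x
      - (1/2) * (\<Sum>e\<in>unit_steps. h x + h (x + e)) \<le> action_density p V u x" for x
  proof -
    have "(\<Sum>e\<in>unit_steps. \<bar>restr B u (x + e) - restr B u x\<bar> powr p
          + \<bar>restr (-B) u (x + e) - restr (-B) u x\<bar> powr p)
        \<le> (\<Sum>e\<in>unit_steps. \<bar>u (x + e) - u x\<bar> powr p + (h x + h (x + e)))"
      by (intro sum_mono edge)
    moreover have half: "1/2 * a + 1/2 * b \<le> 1/2 * c + 1/2 * d" if "a + b \<le> c + d" for a b c d :: real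
      using that by simp
    ultimately have "grad_density p (restr B u) x + grad_density p (restr (- B) u) x
        \<le> grad_density p u x + (1/2) * (\<Sum>e\<in>unit_steps. h x + h (x + e))"
      unfolding grad_density_def by (intro half) (simp add: sum.distrib)
    then show ?thesis by (auto simp: action_density_def restr_def)
  qed
  note s = action_density_summable[of p V, OF p V]
  note ad = admissible_restr[OF adm]
  have "((\<lambda>x. action_density p V (restr B u) x + action_density p V (restr (- B) u) x
      - (1/2) * (\<Sum>e\<in>unit_steps. h x + h (x + e))) has_sum
      (action p V (restr B u) + action p V (restr (- B) u)
      - real (card (unit_steps :: (int ^ 'n) set)) * (\<Sum>x\<in>C. \<bar>u x\<bar> powr p))) UNIV"
    using s[OF ad, of B] s[OF ad, of "-B"] hs unfolding action_def
    by (auto simp: has_sum_iff infsum_add infsum_diff_real summable_on_add summable_on_diff_real)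
  from has_sum_mono[OF this has_sum_infsum[OF s[OF adm]]] dens show ?thesis
    by (simp add: action_def)
qed

section \<open>Derivatives of the power and logarithmic terms\<close>

lemma DERIV_0_if_superlinear:
  fixes f :: "real \<Rightarrow> real"
  assumes a: "a > 0" and f: "f 0 = 0" "\<And>h. \<bar>h\<bar> < 1 \<Longrightarrow> h \<noteq> 0 \<Longrightarrow> \<bar>f h\<bar> \<le> C * \<bar>h\<bar> powr (1 + a)"
  shows "(f has_real_derivative 0) (at 0)"
proof -
  have "((\<lambda>h. C * \<bar>h\<bar> powr a) \<longlongrightarrow> C * \<bar>0\<bar> powr a) (at (0::real))"
    using a by (intro tendsto_intros tendsto_powr') auto
  then have lim: "((\<lambda>h. C * \<bar>h\<bar> powr a) \<longlongrightarrow> 0) (at (0::real))" by simp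
  have "\<forall>\<^sub>F h in at (0::real). \<bar>h\<bar> < 1 \<and> h \<noteq> 0"
    unfolding eventually_at by (intro exI[of _ 1]) (auto simp: dist_real_def)
  then have "\<forall>\<^sub>F h in at 0. norm ((f h - f 0) / (h - 0)) \<le> C * \<bar>h\<bar> powr a"
  proof eventually_elim
    case (elim h)
    then have "\<bar>f h\<bar> / \<bar>h\<bar> \<le> C * \<bar>h\<bar> powr (1 + a) / \<bar>h\<bar>"
      using f(2) by (intro divide_right_mono) auto
    also have "\<dots> = C * \<bar>h\<bar> powr a" using elim by (simp add: powr_add)
    finally show ?case using f(1) by simp
  qed
  then show ?thesis
    unfolding has_field_derivative_iff by (rule Lim_null_comparison) (use lim in simp)
qed

text \<open>For $p>1$ this includes the origin, where the derivative is zero. So the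
  first variation may be computed before the minimizer is known to be positive.\<close>

lemma DERIV_abs_powr:
  fixes p t :: real
  assumes p: "p > 1"
  shows "((\<lambda>t. \<bar>t\<bar> powr p) has_real_derivative p * sgn_powr (p - 2) t) (at t)"
proof -
  consider "t = 0" | "t > 0" | "t < 0" by linarith
  then show ?thesis
  proof cases
    case 1
    have "((\<lambda>t. \<bar>t\<bar> powr p) has_real_derivative 0) (at 0)"
      by (rule DERIV_0_if_superlinear[of "p - 1" _ 1]) (use p in auto)
    then show ?thesis using 1 by (simp add: sgn_powr_def)
  next
    case 2
    have "((\<lambda>t. t powr p) has_real_derivative p * t powr (p - 1)) (at t)"
      using has_real_derivative_powr[of t p] 2 by simp
    moreover have "t powr (p - 1) = sgn_powr (p - 2) t"
      using 2 powr_add[of t "p - 2" 1] by (simp add: sgn_powr_def)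
    ultimately show ?thesis
      by (rule_tac has_field_derivative_transform_within_open[of "\<lambda>t. t powr p" _ _ "{0<..}"])
        (use 2 in auto)
  next
    case 3
    have "((\<lambda>t. (- t) powr p) has_real_derivative (p * (- t) powr (p - 1)) * (- 1)) (at t)"
      by (rule DERIV_chain2[of "\<lambda>t. t powr p"])
        (use 3 has_real_derivative_powr[of "- t" p] in \<open>auto intro!: derivative_eq_intros\<close>)
    moreover have "(- t) powr (p - 1) * (- 1) = sgn_powr (p - 2) t"
      using 3 powr_add[of "- t" "p - 2" 1] by (simp add: sgn_powr_def)
    ultimately have "((\<lambda>t. (- t) powr p) has_real_derivative p * sgn_powr (p - 2) t) (at t)"
      by (simp only: mult.assoc)
    then show ?thesis
      by (rule has_field_derivative_transform_within_open[of _ _ _ "{..<0}"]) (use 3 in auto)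
  qed
qed

text \<open>At the origin the logarithm is dominated by any negative power; half of the
  available exponent $p-1$ is spent on it.\<close>

lemma DERIV_log_term:
  fixes p t :: real
  assumes p: "p > 1"
  shows "(log_term p has_real_derivative p * sgn_powr (p - 2) t * (ln (\<bar>t\<bar> powr p) + 1)) (at t)"
proof (cases "t = 0")
  case True
  \<comment> \<open>The exponent $a$ leaves $|h|^p\,|h|^{-a}=|h|^{1+a}$, which is still superlinear.\<close>
  define a where "a = (p - 1) / 2"
  have a: "a > 0" using p by (simp add: a_def)
  have "\<bar>log_term p h\<bar> \<le> (p / a) * \<bar>h\<bar> powr (1 + a)" if h: "\<bar>h\<bar> < 1" "h \<noteq> 0" for h
  proof -
    have "ln (1 / \<bar>h\<bar>) \<le> (1 / \<bar>h\<bar>) powr a / a"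
      by (rule ln_powr_bound) (use h a in auto)
    then have l: "- ln \<bar>h\<bar> \<le> \<bar>h\<bar> powr (- a) / a"
      using h by (simp add: ln_div powr_minus_divide powr_divide)
    have "ln \<bar>h\<bar> \<le> 0" using h by simp
    then have "\<bar>log_term p h\<bar> = \<bar>h\<bar> powr p * (p * - ln \<bar>h\<bar>)"
      using h p by (simp add: log_term_def ln_powr abs_mult)
    also have "\<dots> \<le> \<bar>h\<bar> powr p * (p * (\<bar>h\<bar> powr (- a) / a))"
      using l p by (intro mult_left_mono) auto
    also have "\<dots> = (p / a) * (\<bar>h\<bar> powr p * \<bar>h\<bar> powr (- a))" by simp
    also have "\<bar>h\<bar> powr p * \<bar>h\<bar> powr (- a) = \<bar>h\<bar> powr (1 + a)"
      unfolding powr_add[symmetric] by (simp add: a_def field_simps)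
    finally show ?thesis .
  qed
  from DERIV_0_if_superlinear[OF a _ this] show ?thesis
    using True by (simp add: sgn_powr_def)
next
  case False
  have "((\<lambda>t. \<bar>t\<bar> powr p * ln (\<bar>t\<bar> powr p)) has_real_derivative
      p * sgn_powr (p - 2) t * ln (\<bar>t\<bar> powr p)
        + (inverse (\<bar>t\<bar> powr p) * (p * sgn_powr (p - 2) t)) * (\<bar>t\<bar> powr p)) (at t)"
    by (rule DERIV_mult[OF DERIV_abs_powr[OF p]
        DERIV_chain2[of ln, OF DERIV_ln DERIV_abs_powr[OF p]]]) (use False in auto)
  then have "(log_term p has_real_derivative
      p * sgn_powr (p - 2) t * ln (\<bar>t\<bar> powr p)
        + (inverse (\<bar>t\<bar> powr p) * (p * sgn_powr (p - 2) t)) * (\<bar>t\<bar> powr p)) (at t)"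
    unfolding log_term_def[abs_def] .
  moreover have "inverse (\<bar>t\<bar> powr p) * c * (\<bar>t\<bar> powr p) = c" for c
    using False by simp
  ultimately show ?thesis by (simp only: distrib_left mult_1_right)
qed

lemma tendsto_abs_powr:
  assumes "(p::real) > 1" "(f \<longlongrightarrow> t) F"
  shows "((\<lambda>x. \<bar>f x\<bar> powr p) \<longlongrightarrow> \<bar>t\<bar> powr p) F"
  using isCont_tendsto_compose[OF DERIV_isCont[OF DERIV_abs_powr[OF assms(1)]] assms(2)] .

lemma tendsto_log_term:
  assumes "p > 1" "(f \<longlongrightarrow> t) F"
  shows "((\<lambda>x. log_term p (f x)) \<longlongrightarrow> log_term p t) F"
  using isCont_tendsto_compose[OF DERIV_isCont[OF DERIV_log_term[OF assms(1)]] assms(2)] .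

lemma tendsto_action_density:
  assumes p: "p > 1" and w: "\<And>x. ((\<lambda>n. w n x) \<longlongrightarrow> w' x) F" and W: "((\<lambda>n. W n x) \<longlongrightarrow> W' x) F"
  shows "((\<lambda>n. action_density p (W n) (w n) x) \<longlongrightarrow> action_density p W' w' x) F"
  unfolding action_density_def grad_density_def
  by (intro tendsto_intros tendsto_abs_powr tendsto_log_term p w W)

section \<open>Compactness of minimizing sequences\<close>

lemma mass_ge_single:
  assumes "lp_summable p u"
  shows "\<bar>u x\<bar> powr p \<le> mass p u"
  using finite_sum_le_infsum[of "\<lambda>x. \<bar>u x\<bar> powr p" UNIV "{x}"] assms
  by (simp add: mass_def lp_summable_def)

lemma log_term_nonpos: "\<bar>t\<bar> powr p \<le> 1 \<Longrightarrow> log_term p t \<le> 0"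
  unfolding log_term_def using ln_le_zero_iff[of "\<bar>t\<bar> powr p"]
  by (cases "t = 0") (simp_all add: mult_nonneg_nonpos del: ln_powr ln_le_zero_iff)

lemma binary_entropy_pos:
  fixes s :: real
  assumes "0 < s" "s < 1"
  shows "0 < - s * ln s - (1 - s) * ln (1 - s)"
proof -
  have "s * ln s < 0" "(1 - s) * ln (1 - s) < 0" using assms by (auto simp: mult_less_0_iff)
  then show ?thesis by simp
qed

text \<open>The potential may vary along the sequence, so that the lemma applies to translated minimizing
  sequences. Let $\alpha$ be the mass of the limit; it is positive because of the vertex \<open>z\<close>. If
  $\alpha<1$, cut along a large finite set that carries almost all of the limit mass. The inner
  piece has mass close to $\alpha$, the outer one close to $1-\alpha$, and the cut costs almost
  nothing, since the limit has little mass near the boundary. The lower bound by $t(I-\ln t)$ on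
  both pieces then gives $-\alpha\ln\alpha-(1-\alpha)\ln(1-\alpha)\le 0$, which is absurd. Once
  $\alpha=1$, Fatou's lemma applies to the action densities, made nonnegative by adding
  $K|w_n|^p$: the added terms have the same total $K$ before and after the limit.\<close>

lemma minimizing_sequence_limit:
  fixes W w :: "nat \<Rightarrow> int ^ 'n \<Rightarrow> real"
  assumes p: "p > 1" and K: "\<And>n x. \<bar>W n x\<bar> \<le> K"
    and W: "\<And>x. (\<lambda>n. W n x) \<longlonglongrightarrow> W' x" and w: "\<And>x. (\<lambda>n. w n x) \<longlonglongrightarrow> w' x"
    and adm: "\<And>n. admissible p (w n)" and mass: "\<And>n. mass p (w n) = 1"
    and act: "(\<lambda>n. action p (W n) (w n)) \<longlonglongrightarrow> I"
    and I: "\<And>n v. admissible p v \<Longrightarrow> mass p v = 1 \<Longrightarrow> I \<le> action p (W n) v"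
    and d: "d > 0" "\<And>n. d \<le> \<bar>w n z\<bar> powr p"
  shows "admissible p w'" "mass p w' = 1" "action p W' w' \<le> I"
proof -
  have p0: "p > 0" using p by simp
  define N where "N = real (card (unit_steps :: (int ^ 'n) set))"
  define H where "H s = - s * ln s - (1 - s) * ln (1 - s)" for s :: real
  define m where "m n x = \<bar>w n x\<bar> powr p" for n x
  define m' where "m' x = \<bar>w' x\<bar> powr p" for x
  have m: "(\<lambda>n. m n x) \<longlonglongrightarrow> m' x" for x
    unfolding m_def m'_def by (rule tendsto_abs_powr[OF p w])
  have m0: "0 \<le> m' x" for x by (simp add: m'_def)
  have "m n summable_on UNIV" "infsum (m n) UNIV \<le> 1" for n
    using admissibleD(2)[OF adm] mass[of n] by (auto simp: m_def[abs_def] mass_def)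
  then have sm': "m' summable_on UNIV" and le1: "infsum m' UNIV \<le> 1"
    using fatou_infsum[of m "\<lambda>_. 1" 1 m'] m by (auto simp: m_def)
  define \<alpha> where "\<alpha> = infsum m' UNIV"
  have fin_le: "sum m' B \<le> \<alpha>" if "finite B" for B
    unfolding \<alpha>_def by (rule finite_sum_le_infsum[OF sm' that]) (auto simp: m0)
  have dz: "d \<le> m' z" by (rule LIMSEQ_le_const[OF m]) (use d in \<open>auto simp: m_def\<close>)
  have a1: "\<alpha> = 1"
  proof (rule ccontr)
    assume "\<alpha> \<noteq> 1"
    then have al: "\<alpha> < 1" using le1 by (simp add: \<alpha>_def)
    have key: "\<exists>s. \<alpha> - \<epsilon> \<le> s \<and> s \<le> \<alpha> \<and> H s \<le> N * \<epsilon>" if "\<epsilon> > 0" for \<epsilon>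
    proof -
      obtain A where A: "finite A" "\<alpha> - \<epsilon> < sum m' A"
        using finite_sum_exhausts_infsum[OF sm' m0 \<open>\<epsilon> > 0\<close>] unfolding \<alpha>_def by blast
      \<comment> \<open>Two layers of neighbours are added to \<open>A'\<close>: the first makes \<open>B\<close>, and edges leaving
         \<open>B\<close> then stay away from \<open>A'\<close>, inside \<open>C\<close>. So the limit has mass at most
         \<open>\<epsilon>\<close> on \<open>C\<close>.\<close>
      define A' where "A' = insert z A"
      define B where "B = A' \<union> (\<Union>e\<in>unit_steps. (\<lambda>x. x + e) ` A')"
      define C where "C = (B \<union> (\<Union>e\<in>unit_steps. (\<lambda>x. x + e) ` B)) - A'"
      have fin: "finite A'" "finite B" "finite C" using A(1) by (auto simp: A'_def B_def C_def)
      have edge: "x \<in> C \<and> x + e \<in> C" if e: "e \<in> unit_steps" and x: "x \<in> B" "x + e \<notin> B" for x e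
      proof -
        have "x \<notin> A'" "x + e \<notin> A'" using e x(2) by (auto simp: B_def)
        then show ?thesis using e x(1) by (auto simp: C_def)
      qed
      define s where "s = sum m' B"
      have A'm: "sum m' A' \<ge> sum m' A" using fin by (intro sum_mono2) (auto simp: A'_def m0)
      have Bm: "sum m' B \<ge> sum m' A'" using fin by (intro sum_mono2) (auto simp: B_def m0)
      have "m' z \<le> s" unfolding s_def
        by (rule member_le_sum) (use fin m0 in \<open>auto simp: B_def A'_def\<close>)
      then have s: "0 < s" "s \<le> \<alpha>" "\<alpha> - \<epsilon> \<le> s"
        using d dz fin_le[OF fin(2)] A(2) A'm Bm by (auto simp: s_def)
      have "sum m' C + sum m' A' = sum m' (C \<union> A')"
        using fin by (subst sum.union_disjoint) (auto simp: C_def)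
      also have "\<dots> \<le> \<alpha>" using fin by (intro fin_le) auto
      finally have r: "sum m' C \<le> \<epsilon>" using A(2) A'm by linarith
      have cut: "sum (m n) B * (I - ln (sum (m n) B)) + (1 - sum (m n) B) * (I - ln (1 - sum (m n) B))
          - N * sum (m n) C \<le> action p (W n) (w n)" for n
      proof -
        have mB: "mass p (restr B (w n)) = sum (m n) B"
          using mass_restr_finite[OF fin(2)] by (simp add: m_def[abs_def])
        have mB': "mass p (restr (- B) (w n)) = 1 - sum (m n) B"
          using mass_restr_compl[OF admissibleD(1)[OF adm[of n]], of B] mB mass by simp
        have low: "mass p (restr D (w n)) * (I - ln (mass p (restr D (w n))))
            \<le> action p (W n) (restr D (w n))" for D
          by (rule action_ge_of_unit_mass_bound[of p "W n", OF p0 K admissible_restr[OF adm]])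
            (rule I)
        have "action p (W n) (restr B (w n)) + action p (W n) (restr (- B) (w n))
            - N * sum (m n) C \<le> action p (W n) (w n)"
          unfolding N_def m_def by (rule action_cut[OF p0 K adm fin(3) edge])
        then show ?thesis using low[of B] low[of "- B"] unfolding mB mB' by linarith
      qed
      have sB: "(\<lambda>n. sum (m n) B) \<longlonglongrightarrow> s" unfolding s_def by (intro tendsto_sum m)
      have "(\<lambda>n. sum (m n) B * (I - ln (sum (m n) B)) + (1 - sum (m n) B) * (I - ln (1 - sum (m n) B))
          - N * sum (m n) C) \<longlonglongrightarrow> s * (I - ln s) + (1 - s) * (I - ln (1 - s)) - N * sum m' C"
        by (intro tendsto_intros sB m) (use s al in auto)
      then have "s * (I - ln s) + (1 - s) * (I - ln (1 - s)) - N * sum m' C \<le> I"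
        by (rule LIMSEQ_le[OF _ act]) (use cut in auto)
      then have "H s \<le> N * sum m' C" by (simp add: H_def algebra_simps)
      also have "\<dots> \<le> N * \<epsilon>" using r by (intro mult_left_mono) (auto simp: N_def)
      finally show ?thesis using s by blast
    qed
    have "\<forall>k. \<exists>s. \<alpha> - inverse (real (Suc k)) \<le> s \<and> s \<le> \<alpha> \<and> H s \<le> N * inverse (real (Suc k))"
      using key by simp
    then obtain S where S: "\<And>k. \<alpha> - inverse (real (Suc k)) \<le> S k" "\<And>k. S k \<le> \<alpha>"
        "\<And>k. H (S k) \<le> N * inverse (real (Suc k))"
      by metis
    have lo: "(\<lambda>k. \<alpha> - inverse (real (Suc k))) \<longlonglongrightarrow> \<alpha> - 0"
      by (intro tendsto_intros LIMSEQ_inverse_real_of_nat)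
    have Sl: "S \<longlonglongrightarrow> \<alpha>"
      by (rule tendsto_sandwich[of "\<lambda>k. \<alpha> - inverse (real (Suc k))" _ _ "\<lambda>_. \<alpha>"]) (use S lo in auto)
    have a0: "0 < \<alpha>" using d dz fin_le[of "{z}"] by simp
    have "(\<lambda>k. H (S k)) \<longlonglongrightarrow> H \<alpha>"
      unfolding H_def by (intro tendsto_intros Sl) (use a0 al in auto)
    moreover have "(\<lambda>k. N * inverse (real (Suc k))) \<longlonglongrightarrow> N * 0"
      by (intro tendsto_intros LIMSEQ_inverse_real_of_nat)
    ultimately have "H \<alpha> \<le> N * 0" by (rule LIMSEQ_le) (use S in auto)
    moreover have "0 < H \<alpha>" unfolding H_def using binary_entropy_pos[OF a0 al] .
    ultimately show False by simp
  qed
  then show mass': "mass p w' = 1" by (simp add: mass_def \<alpha>_def m'_def[abs_def])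
  have lp: "lp_summable p w'" using sm' by (simp add: lp_summable_def m'_def[abs_def])
  \<comment> \<open>The added term offsets the potential, and the logarithmic term has a sign because all values on the unit sphere are at most one in modulus.\<close>
  define G where "G x = action_density p W' w' x + K * m' x" for x
  define g where "g n x = action_density p (W n) (w n) x + K * m n x" for n x
  have KV: "0 \<le> V * t + K * t" if "\<bar>V\<bar> \<le> K" "0 \<le> t" for V t :: real
    using that mult_right_mono[of "- V" K t] by (simp add: abs_le_iff)
  have "\<bar>W' x\<bar> \<le> K" for x
    by (rule LIMSEQ_le_const2[OF tendsto_rabs[OF W]]) (use K in auto)
  note K' = this
  have gn: "0 \<le> g n x" for n x
  proof -
    have "log_term p (w n x) \<le> 0"
      using mass_ge_single[OF admissibleD(1)[OF adm], of n x] mass by (intro log_term_nonpos) simp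
    then show ?thesis
      using grad_density_nonneg[of p "w n" x] KV[OF K, of "m n x" n x]
      by (simp add: g_def action_density_def m_def)
  qed
  have gs: "(g n has_sum (action p (W n) (w n) + K)) UNIV" for n
  proof -
    have "((\<lambda>x. action_density p (W n) (w n) x + K * m n x) has_sum
       (action p (W n) (w n) + K * mass p (w n))) UNIV"
      using action_density_summable[of p "W n", OF p0 K adm, of n] admissibleD(2)[OF adm, of n]
      unfolding action_def mass_def m_def by (intro has_sum_add has_sum_cmult_right) auto
    then show ?thesis using mass by (simp add: g_def[abs_def])
  qed
  have gl: "(\<lambda>n. g n x) \<longlonglongrightarrow> G x" for x
    unfolding g_def G_def by (intro tendsto_intros tendsto_action_density p w W m)
  have G: "G summable_on UNIV" "infsum G UNIV \<le> I + K"
    using fatou_infsum[of g "\<lambda>n. action p (W n) (w n) + K" "I + K" G, OF _ gn _ tendsto_add[OF act tendsto_const] gl] gs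
    by (auto simp: has_sum_iff)
  show adm': "admissible p w'"
    unfolding admissible_def
  proof (intro conjI lp summable_on_if_abs_le[OF G(1)])
    fix x
    have "log_term p (w' x) \<le> 0"
      using mass_ge_single[OF lp, of x] mass' by (intro log_term_nonpos) simp
    then show "\<bar>log_term p (w' x)\<bar> \<le> G x"
      using grad_density_nonneg[of p w' x] KV[OF K', of "m' x" x]
      by (simp add: G_def action_density_def m'_def)
  qed
  have "infsum G UNIV = action p W' w' + K * \<alpha>"
    unfolding G_def action_def \<alpha>_def infsum_cmult_right'[symmetric]
    using action_density_summable[of p W', OF p0 K' adm'] sm'
    by (intro infsum_add summable_on_cmult_right)
  then show "action p W' w' \<le> I" using G(2) a1 by simp
qed

section \<open>Existence of a minimizer on the unit sphere\<close>

text \<open>Tychonoff's theorem: over a countable index set the cube is metrizable, so compactness is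
  sequential.\<close>

lemma pointwise_convergent_subsequence:
  fixes w :: "nat \<Rightarrow> 'a :: countable \<Rightarrow> real"
  assumes "\<And>n x. \<bar>w n x\<bar> \<le> 1"
  obtains r l where "strict_mono r" "\<And>x. (\<lambda>n. w (r n) x) \<longlonglongrightarrow> l x"
proof -
  have "compact (PiE (UNIV :: 'a set) (\<lambda>_. {-1..1 :: real}))"
    using compactin_PiE[of "\<lambda>_ :: 'a. euclidean :: real topology" UNIV "\<lambda>_. {-1..1}"]
    by (simp add: euclidean_product_topology)
  then have "seq_compact (PiE (UNIV :: 'a set) (\<lambda>_. {-1..1 :: real}))"
    by (rule compact_imp_seq_compact)
  moreover have "\<forall>n. w n \<in> PiE (UNIV :: 'a set) (\<lambda>_. {-1..1 :: real})"
    using assms by (auto simp: PiE_def abs_le_iff minus_le_iff)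
  ultimately obtain l r where r: "strict_mono r" "(w \<circ> r) \<longlonglongrightarrow> l"
    unfolding seq_compact_def by blast
  have "(\<lambda>n. w (r n) x) \<longlonglongrightarrow> l x" for x
    using continuous_on_tendsto_compose[OF continuous_on_product_coordinates[of x] r(2)]
    by (simp add: o_def)
  then show ?thesis using that r(1) by blast
qed

lemma admissible_translate:
  fixes u :: "int ^ 'n \<Rightarrow> real"
  shows "admissible p (\<lambda>x. u (x + a)) \<longleftrightarrow> admissible p u"
  unfolding admissible_def lp_summable_def
  using summable_on_translate[of "\<lambda>x. \<bar>u x\<bar> powr p" a]
    summable_on_translate[of "\<lambda>x. log_term p (u x)" a] by simp

lemma mass_translate:
  fixes u :: "int ^ 'n \<Rightarrow> real"
  shows "mass p (\<lambda>x. u (x + a)) = mass p u"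
  unfolding mass_def by (rule infsum_translate)

lemma action_translate:
  fixes u :: "int ^ 'n \<Rightarrow> real"
  shows "action p (\<lambda>x. V (x + a)) (\<lambda>x. u (x + a)) = action p V u"
proof -
  have "action_density p (\<lambda>x. V (x + a)) (\<lambda>x. u (x + a)) x = action_density p V u (x + a)" for x
    by (simp add: action_density_def grad_density_def add.assoc add.commute[of a])
  then have "action p (\<lambda>x. V (x + a)) (\<lambda>x. u (x + a)) = (\<Sum>\<^sub>\<infinity>x. action_density p V u (x + a))"
    unfolding action_def by (intro infsum_cong) simp
  then show ?thesis unfolding action_def infsum_translate .
qed

lemma action_mono_potential:
  assumes "p > 0" "\<And>x. \<bar>V x\<bar> \<le> K" "\<And>x. \<bar>W x\<bar> \<le> K" "\<And>x. V x \<le> W x" "admissible p u"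
  shows "action p V u \<le> action p W u"
  unfolding action_def
  using action_density_summable[of p V, OF assms(1,2,5)] action_density_summable[of p W, OF assms(1,3,5)]
  by (rule infsum_mono) (use assms(4) in \<open>auto simp: action_density_def intro!: mult_right_mono\<close>)

lemma admissible_abs: "admissible p (\<lambda>x. \<bar>u x\<bar>) \<longleftrightarrow> admissible p u"
  by (simp add: admissible_def lp_summable_def)

lemma action_abs_le:
  assumes "p > 0" "\<And>x. \<bar>V x\<bar> \<le> K" "admissible p u"
  shows "action p V (\<lambda>x. \<bar>u x\<bar>) \<le> action p V u"
proof -
  have "grad_density p (\<lambda>x. \<bar>u x\<bar>) x \<le> grad_density p u x" for x
    unfolding grad_density_def using assms(1)
    by (intro mult_left_mono sum_mono powr_mono2) auto
  then show ?thesis unfolding action_def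
    using action_density_summable[of p V, OF assms(1,2,3)]
      action_density_summable[of p V "K" "\<lambda>x. \<bar>u x\<bar>", OF assms(1,2)] assms(3)
    by (intro infsum_mono) (auto simp: action_density_def admissible_abs)
qed

lemma admissible_finite_support:
  assumes "finite {x. u x \<noteq> 0}"
  shows "admissible p u"
  unfolding admissible_def lp_summable_def
  using assms by (auto intro!: finite_nonzero_values_imp_summable_on elim!: finite_subset[rotated])

text \<open>Translate a minimizing sequence so that a vertex of substantial mass sits at the origin. If
  the translations \<open>y\<close> repeat some value infinitely often, the limit is translated back; otherwise
  they leave every ball, the limiting potential is the constant \<open>Vinf\<close>, and the limit function
  needs no correction because lowering the potential lowers the action.\<close>

lemma action_minimizer_exists:
  fixes V :: "int ^ 'n \<Rightarrow> real"
  assumes p: "p > 1" and K: "\<And>x. \<bar>V x\<bar> \<le> K" "\<bar>Vinf\<bar> \<le> K" and Vle: "\<And>x. V x \<le> Vinf"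
    and lim: "(V \<longlongrightarrow> Vinf) (filtercomap lattice_norm at_top)"
  obtains w where "admissible p w" "mass p w = 1" "\<And>x. 0 \<le> w x"
    "\<And>v. admissible p v \<Longrightarrow> mass p v = 1 \<Longrightarrow> action p V w \<le> action p V v"
proof -
  have p0: "p > 0" using p by simp
  define S where "S = {v :: int ^ 'n \<Rightarrow> real. admissible p v \<and> mass p v = 1}"
  define I where "I = Inf (action p V ` S)"
  have "restr {0} (\<lambda>_. 1) \<in> S"
    using mass_restr_finite[of "{0}" p "\<lambda>_ :: int ^ 'n. 1"]
    by (auto simp: S_def restr_def intro!: admissible_finite_support)
  then have S_ne: "S \<noteq> {}" by auto
  have low: "- K - ln d \<le> action p V v" if "v \<in> S" "d > 0" "\<And>x. \<bar>v x\<bar> powr p \<le> d" for v d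
  proof -
    have "- K \<le> V x" for x using K(1)[of x] by linarith
    from action_ge_if_small[of p V K "-K" v d, OF p0 K(1) this] that show ?thesis
      by (simp add: S_def)
  qed
  have le1: "\<bar>v x\<bar> powr p \<le> 1" if "v \<in> S" for v x
    using mass_ge_single[of p v x] that by (simp add: S_def admissible_def)
  have bdd: "bdd_below (action p V ` S)"
    using low[of _ 1] le1 by (intro bdd_belowI2[of _ "- K"]) auto
  have I: "I \<le> action p V v" if "v \<in> S" for v
    unfolding I_def by (rule cINF_lower[OF bdd that])
  have "\<exists>v\<in>S. action p V v < I + inverse (real (Suc n))" for n
    using cInf_lessD[of "action p V ` S" "I + inverse (real (Suc n))"] S_ne by (auto simp: I_def)
  then obtain v where v: "\<And>n. v n \<in> S" "\<And>n. action p V (v n) < I + inverse (real (Suc n))"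
    by metis
  have act: "(\<lambda>n. action p V (v n)) \<longlonglongrightarrow> I"
  proof (rule tendsto_sandwich[of "\<lambda>_. I" _ _ "\<lambda>n. I + inverse (real (Suc n))"])
    show "(\<lambda>n. I + inverse (real (Suc n))) \<longlonglongrightarrow> I"
      using LIMSEQ_inverse_real_of_nat_add .
  qed (use I v in \<open>auto intro!: always_eventually less_imp_le\<close>)
  \<comment> \<open>Chosen so that values below $d$ everywhere would force the action to be at least $I+1$, which no member of the sequence reaches.\<close>
  define d where "d = exp (- K - I - 1)"
  have "\<exists>y. d < \<bar>v n y\<bar> powr p" for n
  proof (rule ccontr)
    assume "\<not> ?thesis"
    then have "- K - ln d \<le> action p V (v n)" by (intro low v) (auto simp: d_def not_less)
    moreover have "inverse (real (Suc n)) \<le> 1" by (simp add: field_simps)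
    ultimately show False using v(2)[of n] by (simp add: d_def)
  qed
  then obtain y where y: "\<And>n. d < \<bar>v n (y n)\<bar> powr p" by metis
  have "\<exists>s W'. strict_mono s \<and> (\<forall>x. (\<lambda>n. V (x + y (s n))) \<longlonglongrightarrow> W' x)
      \<and> (\<forall>w\<in>S. action p W' w \<le> I \<longrightarrow> (\<exists>w'\<in>S. action p V w' \<le> I))"
  proof (cases "\<exists>a. infinite {n. y n = a}")
    case True
    then obtain a where a: "infinite {n. y n = a}" by blast
    from infinite_enumerate[OF this] obtain s :: "nat \<Rightarrow> nat"
      where s: "strict_mono s" "\<And>n. y (s n) = a" by blast
    show ?thesis
    proof (intro exI[of _ s] exI[of _ "\<lambda>x. V (x + a)"] conjI allI ballI impI s(1))
      show "(\<lambda>n. V (x + y (s n))) \<longlonglongrightarrow> V (x + a)" for x by (simp add: s(2))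
      fix w assume w: "w \<in> S" "action p (\<lambda>x. V (x + a)) w \<le> I"
      show "\<exists>w'\<in>S. action p V w' \<le> I"
        using w action_translate[of p V a "\<lambda>x. w (x + - a)"] mass_translate[of p w "- a"]
          admissible_translate[of p w "- a"]
        by (intro bexI[of _ "\<lambda>x. w (x + - a)"]) (auto simp: S_def)
    qed
  next
    case False
    have "filterlim (\<lambda>n. x + y n) (filtercomap lattice_norm at_top) sequentially" for x
      unfolding filterlim_filtercomap_iff filterlim_at_top o_def
    proof
      fix R :: int
      have "{n. lattice_norm (x + y n) \<le> R} \<subseteq> (\<Union>b\<in>{b. lattice_norm b \<le> R}. {n. y n = b - x})"
        by (auto simp: algebra_simps)
      then have "finite {n. lattice_norm (x + y n) \<le> R}"
        by (rule finite_subset) (use False finite_lattice_ball in auto)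
      then have "\<forall>\<^sub>F n in cofinite. \<not> lattice_norm (x + y n) \<le> R"
        by (simp add: eventually_cofinite)
      then show "\<forall>\<^sub>F n in sequentially. R \<le> lattice_norm (x + y n)"
        unfolding cofinite_eq_sequentially by eventually_elim simp
    qed
    then have "(\<lambda>n. V (x + y n)) \<longlonglongrightarrow> Vinf" for x
      using filterlim_compose[OF lim] by blast
    moreover have "action p V w \<le> action p (\<lambda>_. Vinf) w" if "w \<in> S" for w
      by (rule action_mono_potential[of p V K]) (use p0 K Vle that in \<open>auto simp: S_def\<close>)
    ultimately show ?thesis
      by (intro exI[of _ id] exI[of _ "\<lambda>_. Vinf"]) (auto simp: strict_mono_id intro: order_trans)
  qed
  then obtain s W' where s: "strict_mono s" "\<And>x. (\<lambda>n. V (x + y (s n))) \<longlonglongrightarrow> W' x"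
    and pull_back: "\<And>w. w \<in> S \<Longrightarrow> action p W' w \<le> I \<Longrightarrow> \<exists>w'\<in>S. action p V w' \<le> I" by blast
  define u where "u n x = v (s n) (x + y (s n))" for n x
  have "\<bar>u n x\<bar> \<le> 1" for n x
  proof (rule ccontr)
    assume "\<not> \<bar>u n x\<bar> \<le> 1"
    then have "1 < \<bar>u n x\<bar> powr p" using p0 by (intro gr_one_powr) auto
    then show False using le1[OF v(1), of "s n" "x + y (s n)"] unfolding u_def by linarith
  qed
  then obtain r w where r: "strict_mono r" "\<And>x. (\<lambda>n. u (r n) x) \<longlonglongrightarrow> w x"
    using pointwise_convergent_subsequence[of u] by blast
  have "w \<in> S \<and> action p W' w \<le> I"
  proof -
    have u_adm: "admissible p (u (r n))" "mass p (u (r n)) = 1" for n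
      using v(1)[of "s (r n)"] by (auto simp: S_def u_def[abs_def] admissible_translate mass_translate)
    have u_act: "(\<lambda>n. action p (\<lambda>x. V (x + y (s (r n)))) (u (r n))) \<longlonglongrightarrow> I"
      using LIMSEQ_subseq_LIMSEQ[OF act strict_mono_o[OF s(1) r(1)]]
      unfolding u_def[abs_def] action_translate by (simp add: o_def)
    have I_le: "I \<le> action p (\<lambda>x. V (x + y (s (r n)))) f" if "admissible p f" "mass p f = 1" for n f
    proof -
      have "(\<lambda>x. f (x + - y (s (r n)))) \<in> S"
        unfolding S_def mem_Collect_eq admissible_translate mass_translate using that by simp
      from I[OF this] show ?thesis
        using action_translate[of p V "y (s (r n))" "\<lambda>x. f (x + - y (s (r n)))"] by simp
    qed
    have W_lim: "(\<lambda>n. V (x + y (s (r n)))) \<longlonglongrightarrow> W' x" for x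
      using LIMSEQ_subseq_LIMSEQ[OF s(2) r(1)] by (simp add: o_def)
    have "d > 0" "\<And>n. d \<le> \<bar>u (r n) 0\<bar> powr p"
      using y by (auto simp: d_def u_def less_imp_le)
    note minimizing_sequence_limit[where W="\<lambda>n x. V (x + y (s (r n)))",
      OF p K(1) W_lim r(2) u_adm u_act I_le this]
    then show ?thesis by (simp add: S_def)
  qed
  then obtain w' where w': "w' \<in> S" "action p V w' \<le> I" using pull_back by blast
  show ?thesis
  proof
    show "admissible p (\<lambda>x. \<bar>w' x\<bar>)" "mass p (\<lambda>x. \<bar>w' x\<bar>) = 1"
      using w'(1) by (auto simp: S_def admissible_abs mass_def)
    show "action p V (\<lambda>x. \<bar>w' x\<bar>) \<le> action p V f" if "admissible p f" "mass p f = 1" for f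
      using action_abs_le[of p V K w', OF p0 K(1)] w' I[of f] that by (auto simp: S_def)
  qed auto
qed

section \<open>Euler--Lagrange equation and positivity\<close>

text \<open>Vary the value at \<open>z\<close> alone. The difference of the action and its lower bound
  $m(I-\ln m)$ is nonnegative along the variation and zero at the minimizer, so its
  derivative vanishes. Using this bound as the comparison function makes a renormalization of the
  varied function unnecessary. The constant $I$ in the equation is the Lagrange multiplier.\<close>

lemma minimizer_euler_lagrange:
  fixes V :: "int ^ 'n \<Rightarrow> real"
  assumes p: "p > 1" and K: "\<And>x. \<bar>V x\<bar> \<le> K"
    and w: "admissible p w" "mass p w = 1"
    and min: "\<And>v. admissible p v \<Longrightarrow> mass p v = 1 \<Longrightarrow> action p V w \<le> action p V v"
  shows "- p_laplacian p w z + V z * sgn_powr (p - 2) (w z)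
    = sgn_powr (p - 2) (w z) * (ln (\<bar>w z\<bar> powr p) + action p V w)"
proof -
  have p0: "p > 0" using p by simp
  define I where "I = action p V w"
  define s where "s = sgn_powr (p - 2)"
  \<comment> \<open>The direction of the variation; only the densities at \<open>z\<close> and its neighbours, the set \<open>B\<close>, change.\<close>
  define c where "c x = (if x = z then 1 else 0 :: real)" for x
  define u where "u t x = w x + t * c x" for t x
  define B where "B = insert z ((\<lambda>e. z + e) ` unit_steps)"
  have finB: "finite B" by (simp add: B_def)
  have off: "c x = 0" if "x \<notin> B" for x using that by (auto simp: c_def B_def)
  have off': "c (x + e) = 0" if "x \<notin> B" "e \<in> unit_steps" for x e
  proof -
    have "x = z + - e \<Longrightarrow> x \<in> B" using that(2) by (auto simp: B_def)
    then show ?thesis using that(1) by (auto simp: c_def)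
  qed
  have adm: "admissible p (u t)" for t
    unfolding admissible_def lp_summable_def
    using finite_change(1)[OF admissibleD(2)[OF w(1)], of B "\<lambda>x. \<bar>u t x\<bar> powr p"]
      finite_change(1)[OF admissibleD(3)[OF w(1)], of B "\<lambda>x. log_term p (u t x)"] finB off
    by (simp add: u_def)
  define M where "M t = 1 + (\<Sum>x\<in>B. \<bar>u t x\<bar> powr p - \<bar>w x\<bar> powr p)" for t
  define A where "A t = I + (\<Sum>x\<in>B. action_density p V (u t) x - action_density p V w x)" for t
  have M: "mass p (u t) = M t" for t
    using finite_change(2)[OF admissibleD(2)[OF w(1)], of B "\<lambda>x. \<bar>u t x\<bar> powr p"] finB off w(2)
    by (simp add: u_def M_def mass_def)
  have A: "action p V (u t) = A t" for t
    unfolding action_def A_def I_def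
  proof (rule finite_change(2)[OF action_density_summable[of p V, OF p0 K w(1)] finB])
    fix x assume "x \<notin> B"
    then show "action_density p V (u t) x = action_density p V w x"
      using off off' by (simp add: action_density_def grad_density_def u_def)
  qed
  define \<Phi> where "\<Phi> t = A t - M t * (I - ln (M t))" for t
  have "0 \<le> \<Phi> t" for t
    using action_ge_of_unit_mass_bound[of p V K "u t" I, OF p0 K adm] min
    by (simp add: \<Phi>_def M A I_def)
  moreover have u0: "u 0 = w" by (simp add: u_def fun_eq_iff)
  then have at0: "u 0 = w" "M 0 = 1" "A 0 = I" by (auto simp: M_def A_def)
  then have "\<Phi> 0 = 0" by (simp add: \<Phi>_def)
  ultimately have min0: "\<forall>t. \<bar>0 - t\<bar> < 1 \<longrightarrow> \<Phi> 0 \<le> \<Phi> t" by simp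
  have lin: "((\<lambda>t. a + t * b) has_real_derivative b) (at 0)" for a b :: real
    by (auto intro!: derivative_eq_intros)
  have comp: "((\<lambda>t. \<bar>a + t * b\<bar> powr p) has_real_derivative p * s a * b) (at 0)" for a b
    unfolding s_def
    by (rule DERIV_chain2[of "\<lambda>t. \<bar>t\<bar> powr p", OF _ lin]) (use DERIV_abs_powr[OF p, of a] in simp)
  have compl: "((\<lambda>t. log_term p (a + t * b)) has_real_derivative p * s a * (ln (\<bar>a\<bar> powr p) + 1) * b) (at 0)" for a b
    unfolding s_def
    by (rule DERIV_chain2[of "log_term p", OF _ lin]) (use DERIV_log_term[OF p, of a] in simp)
  have sumB: "(\<Sum>x\<in>B. f x * c x) = f z" for f :: "int ^ 'n \<Rightarrow> real"
    using finB by (simp add: c_def B_def if_distrib[of "\<lambda>y. _ * y"] sum.delta cong: if_cong)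
  have dM: "(M has_real_derivative p * s (w z)) (at 0)"
  proof -
    have "(M has_real_derivative 0 + (\<Sum>x\<in>B. p * s (w x) * c x - 0)) (at 0)"
      unfolding M_def u_def by (intro DERIV_add DERIV_const DERIV_sum DERIV_diff comp)
    then show ?thesis by (simp add: sumB)
  qed
  define g where "g x = (1/2) * (\<Sum>e\<in>unit_steps. p * s (w (x + e) - w x) * (c (x + e) - c x))" for x
  have dA: "(A has_real_derivative (\<Sum>x\<in>B. g x)
      + (V z * (p * s (w z)) - p * s (w z) * (ln (\<bar>w z\<bar> powr p) + 1))) (at 0)"
  proof -
    have "u t (x + e) - u t x = (w (x + e) - w x) + t * (c (x + e) - c x)" for t x e
      by (simp add: u_def algebra_simps)
    then have "(A has_real_derivative 0 + (\<Sum>x\<in>B. (g x + V x * (p * s (w x) * c x)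
        - p * s (w x) * (ln (\<bar>w x\<bar> powr p) + 1) * c x) - 0)) (at 0)"
      unfolding A_def action_density_def grad_density_def g_def
      by (simp only:) (unfold u_def, intro DERIV_add DERIV_const DERIV_sum DERIV_diff DERIV_cmult comp compl)
    moreover have "(\<Sum>x\<in>B. (g x + V x * (p * s (w x) * c x) - p * s (w x) * (ln (\<bar>w x\<bar> powr p) + 1) * c x) - 0)
      = (\<Sum>x\<in>B. g x) + ((\<Sum>x\<in>B. (V x * (p * s (w x))) * c x)
          - (\<Sum>x\<in>B. (p * s (w x) * (ln (\<bar>w x\<bar> powr p) + 1)) * c x))"
      by (simp add: sum.distrib sum_subtractf algebra_simps)
    ultimately show ?thesis unfolding sumB by simp
  qed
  have s_minus: "s (- a) = - s a" for a by (simp add: s_def sgn_powr_def)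
  have lap: "p_laplacian p w z = (\<Sum>e\<in>unit_steps. s (w (z + e) - w z))"
    by (simp add: p_laplacian_def sum_nbrs s_def)
  have "(\<Sum>x\<in>B. g x) = - p * p_laplacian p w z"
  proof -
    have inner: "(\<Sum>x\<in>B. p * s (w (x + e) - w x) * c (x + e)) = - p * s (w (z + - e) - w z)"
      if e: "e \<in> unit_steps" for e
    proof -
      have "(\<Sum>x\<in>B. p * s (w (x + e) - w x) * c (x + e))
          = (\<Sum>x\<in>B. if x = z - e then p * s (w (x + e) - w x) else 0)"
        by (rule sum.cong) (auto simp: c_def algebra_simps)
      also have "\<dots> = p * s (w z - w (z - e))"
      proof -
        have "z + - e \<in> B" using e unfolding B_def by (intro insertI2 imageI) simp
        then show ?thesis using finB by (simp add: sum.delta)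
      qed
      also have "w z - w (z - e) = - (w (z + - e) - w z)" by simp
      finally show ?thesis unfolding s_minus by simp
    qed
    have "(\<Sum>x\<in>B. g x) = (1/2) * (\<Sum>x\<in>B. \<Sum>e\<in>unit_steps. p * s (w (x + e) - w x) * c (x + e)
        - p * s (w (x + e) - w x) * c x)"
      by (simp add: g_def sum_distrib_left right_diff_distrib)
    also have "\<dots> = (1/2) * (\<Sum>e\<in>unit_steps. (\<Sum>x\<in>B. p * s (w (x + e) - w x) * c (x + e))
        - (\<Sum>x\<in>B. p * s (w (x + e) - w x) * c x))"
      by (subst sum.swap) (simp only: sum_subtractf)
    also have "\<dots> = (1/2) * (\<Sum>e\<in>unit_steps. - p * s (w (z + - e) - w z) - p * s (w (z + e) - w z))"
      unfolding sumB by (intro arg_cong[where f="\<lambda>t. (1/2) * t"] sum.cong refl) (simp add: inner)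
    also have "\<dots> = (1/2) * (- p * (\<Sum>e\<in>unit_steps. s (w (z + - e) - w z))
        - p * (\<Sum>e\<in>unit_steps. s (w (z + e) - w z)))"
      by (simp only: sum_subtractf sum_distrib_left)
    also have "(\<Sum>e\<in>unit_steps. s (w (z + - e) - w z)) = p_laplacian p w z"
      unfolding lap by (rule sum_unit_steps_uminus[of "\<lambda>e. s (w (z + e) - w z)"])
    finally show ?thesis by (simp add: lap[symmetric])
  qed
  note gsum = this
  have "(\<Phi> has_real_derivative
      - p * p_laplacian p w z + (V z * (p * s (w z)) - p * s (w z) * (ln (\<bar>w z\<bar> powr p) + 1))
      - (p * s (w z) * (I - ln (M 0)) + (0 - inverse (M 0) * (p * s (w z))) * M 0)) (at 0)"
    unfolding \<Phi>_def using dA unfolding gsum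
    by (intro DERIV_diff DERIV_mult DERIV_const dM DERIV_chain2[of ln, OF DERIV_ln dM]) (simp_all add: at0)
  from DERIV_local_min[OF this _ min0]
  have "p * (- p_laplacian p w z + V z * s (w z) - s (w z) * (ln (\<bar>w z\<bar> powr p) + I)) = 0"
    using at0 by (simp add: algebra_simps)
  then show ?thesis using p0 by (simp add: s_def I_def)
qed

text \<open>At a zero of $w\ge0$ the equation reduces to $\sum_{y\sim x}w(y)^{p-1}=0$, so all neighbours
  are zeros too, and zeros spread over the connected lattice.\<close>

lemma minimizer_positive:
  fixes w V :: "int ^ 'n \<Rightarrow> real"
  assumes nn: "\<And>x. 0 \<le> w x" and ne: "w \<noteq> (\<lambda>x. 0)"
    and eq: "\<And>x. - p_laplacian p w x + V x * sgn_powr (p - 2) (w x) = sgn_powr (p - 2) (w x) * F x"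
  shows "0 < w x"
proof (rule ccontr)
  assume "\<not> 0 < w x"
  then have z: "w x = 0" using nn[of x] by simp
  have "w y = 0" for y
  proof (induction y rule: neighbour_step_induct[of "\<lambda>y. w y = 0", OF z])
    case (1 y e)
    have "(\<Sum>e\<in>unit_steps. sgn_powr (p - 2) (w (y + e))) = 0"
      using eq[of y] 1(1) by (simp add: sgn_powr_def p_laplacian_def sum_nbrs)
    then have "sgn_powr (p - 2) (w (y + e)) = 0"
      using 1(2) nn by (subst (asm) sum_nonneg_eq_0_iff) (auto simp: sgn_powr_def)
    then show ?case by (simp add: sgn_powr_def)
  qed
  then show False using ne by auto
qed

section \<open>Energy, domain and Nehari manifold in terms of the action\<close>

lemma integrable_count_space_iff_summable_on:
  fixes f :: "'a \<Rightarrow> real"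
  shows "integrable (count_space UNIV) f \<longleftrightarrow> f summable_on UNIV"
  using abs_summable_equivalent[of f UNIV] summable_on_iff_abs_summable_on_real[of f UNIV]
  by (simp add: Infinite_Set_Sum.abs_summable_on_def)

lemma integral_count_space_eq_infsum:
  fixes f :: "'a \<Rightarrow> real"
  assumes "f summable_on UNIV"
  shows "(LINT x|count_space UNIV. f x) = infsum f UNIV"
  using infsetsum_infsum[of f UNIV] assms integrable_count_space_iff_summable_on[of f]
  by (simp add: infsetsum_def Infinite_Set_Sum.abs_summable_on_def)

lemma ext_integral_eq_infsum:
  fixes f :: "int ^ 'n \<Rightarrow> real"
  assumes "f summable_on UNIV"
  shows "ext_integral f = ereal (infsum f UNIV)"
proof -
  have int: "integrable (count_space UNIV) f"
    using assms by (simp add: integrable_count_space_iff_summable_on)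
  have fin: "enn2ereal y = ereal (enn2real y)" if "y \<noteq> \<infinity>" for y
    using that by (cases y rule: ennreal_cases) (auto simp: enn2ereal_ennreal)
  have "(\<integral>\<^sup>+x. ennreal (f x) \<partial>count_space UNIV) \<noteq> \<infinity>"
    "(\<integral>\<^sup>+x. ennreal (- f x) \<partial>count_space UNIV) \<noteq> \<infinity>"
    using int by (auto simp: real_integrable_def)
  then show ?thesis
    using real_lebesgue_integral_def[OF int] integral_count_space_eq_infsum[OF assms]
    by (simp add: ext_integral_def fin)
qed

lemma grad_norm_powr:
  assumes "p > 0"
  shows "grad_norm p u x powr p = grad_density p u x"
proof -
  have "0 \<le> (1/2) * (\<Sum>y\<in>nbrs x. \<bar>u y - u x\<bar> powr p)" by (simp add: sum_nonneg)
  then show ?thesis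
    using assms by (simp add: grad_norm_def powr_powr grad_density_def sum_nbrs)
qed

lemma sobolev_density_eq:
  assumes "p > 0"
  shows "sobolev_density p u x = grad_density p u x + \<bar>u x\<bar> powr p"
  by (simp add: sobolev_density_def grad_norm_powr[OF assms])

lemma sobolev_density_summable:
  assumes "p > 0" "lp_summable p u"
  shows "sobolev_density p u summable_on UNIV"
  unfolding sobolev_density_eq[OF assms(1), abs_def]
  using grad_density_summable(1)[OF assms] assms(2)
  by (intro summable_on_add) (auto simp: lp_summable_def)

lemma sobolev_norm_le:
  fixes u :: "int ^ 'n \<Rightarrow> real"
  assumes "p > 0" "lp_summable p u"
  shows "sobolev_norm p u
    \<le> ((2 powr p * real (card (unit_steps :: (int ^ 'n) set)) + 1) * mass p u) powr (1 / p)"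
proof -
  have "infsum (sobolev_density p u) UNIV = infsum (grad_density p u) UNIV + mass p u"
    unfolding sobolev_density_eq[OF assms(1), abs_def] mass_def
    using grad_density_summable(1)[OF assms] assms(2)
    by (intro infsum_add) (auto simp: lp_summable_def)
  also have "\<dots> \<le> (2 powr p * real (card (unit_steps :: (int ^ 'n) set)) + 1) * mass p u"
    using grad_density_summable(2)[OF assms] by (simp add: algebra_simps)
  finally have le: "infsum (sobolev_density p u) UNIV
    \<le> (2 powr p * real (card (unit_steps :: (int ^ 'n) set)) + 1) * mass p u" .
  have "0 \<le> infsum (sobolev_density p u) UNIV"
    by (intro infsum_nonneg) (simp add: sobolev_density_def)
  with le show ?thesis
    unfolding sobolev_norm_def integral_count_space_eq_infsum[OF sobolev_density_summable[OF assms]]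
    using assms(1) by (intro powr_mono2) auto
qed

text \<open>Truncations to finite sets exhausting the mass converge in the Sobolev norm, since that norm
  is bounded by the mass of the remainder.\<close>

lemma W1p_iff_lp_summable:
  fixes u :: "int ^ 'n \<Rightarrow> real"
  assumes p: "p > 0"
  shows "u \<in> W1p p \<longleftrightarrow> lp_summable p u"
proof
  assume "u \<in> W1p p"
  then have "sobolev_density p u summable_on UNIV"
    by (simp add: W1p_def integrable_count_space_iff_summable_on)
  then show "lp_summable p u"
    unfolding lp_summable_def
    by (rule summable_on_if_abs_le) (simp add: sobolev_density_def)
next
  assume u: "lp_summable p u"
  define c where "c = 2 powr p * real (card (unit_steps :: (int ^ 'n) set)) + 1"
  have "\<exists>A. finite A \<and> mass p u - inverse (real (Suc k)) < (\<Sum>x\<in>A. \<bar>u x\<bar> powr p)" for k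
    using finite_sum_exhausts_infsum[of "\<lambda>x. \<bar>u x\<bar> powr p" "inverse (real (Suc k))"] u
    by (auto simp: lp_summable_def mass_def)
  then obtain A where A: "\<And>k. finite (A k)"
    "\<And>k. mass p u - inverse (real (Suc k)) < (\<Sum>x\<in>A k. \<bar>u x\<bar> powr p)" by metis
  define f where "f k = restr (A k) u" for k
  have f: "(\<lambda>x. u x - f k x) = restr (- A k) u" for k
    by (auto simp: f_def restr_def)
  have norm_le: "sobolev_norm p (\<lambda>x. u x - f k x) \<le> (c * inverse (real (Suc k))) powr (1 / p)" for k
  proof -
    have "mass p (restr (- A k) u) \<le> inverse (real (Suc k))"
      unfolding mass_restr_compl[OF u] mass_restr_finite[OF A(1)] using A(2)[of k] by simp
    then have "(c * mass p (restr (- A k) u)) powr (1 / p) \<le> (c * inverse (real (Suc k))) powr (1 / p)"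
      using p by (intro powr_mono2 mult_left_mono mult_nonneg_nonneg mass_nonneg) (auto simp: c_def)
    then show ?thesis
      using sobolev_norm_le[OF p lp_summable_restr[OF u], of "- A k"] unfolding f c_def by simp
  qed
  have "(\<lambda>k. (c * inverse (real (Suc k))) powr (1 / p)) \<longlonglongrightarrow> (c * 0) powr (1 / p)"
    using p by (intro tendsto_powr' tendsto_intros LIMSEQ_inverse_real_of_nat) (auto simp: c_def)
  then have bound: "(\<lambda>k. (c * inverse (real (Suc k))) powr (1 / p)) \<longlonglongrightarrow> 0" by simp
  have "0 \<le> sobolev_norm p (\<lambda>x. u x - f k x)" for k by (simp add: sobolev_norm_def)
  then have "(\<lambda>k. sobolev_norm p (\<lambda>x. u x - f k x)) \<longlonglongrightarrow> 0"
    by (intro tendsto_sandwich[OF _ _ tendsto_const bound] always_eventually allI norm_le)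
  moreover have "finite {x. f k x \<noteq> 0}" for k
    using A(1) by (rule finite_subset[rotated]) (auto simp: f_def restr_def)
  ultimately show "u \<in> W1p p"
    using sobolev_density_summable[OF p u]
    by (auto simp: W1p_def integrable_count_space_iff_summable_on)
qed

lemma log_integral_eq:
  assumes "admissible p u"
  shows "log_integral p u = ereal (\<Sum>\<^sub>\<infinity>x. log_term p (u x))"
  using ext_integral_eq_infsum[OF admissibleD(3)[OF assms]] by (simp add: log_integral_def log_term_def)

lemma ext_integral_dirichlet:
  assumes "p > 0" "\<And>x. \<bar>V x\<bar> \<le> K" "admissible p u"
  shows "ext_integral (\<lambda>x. grad_norm p u x powr p + V x * \<bar>u x\<bar> powr p)
    = ereal (action p V u + (\<Sum>\<^sub>\<infinity>x. log_term p (u x)))"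
proof -
  have "((\<lambda>x. action_density p V u x + log_term p (u x)) has_sum
      (action p V u + (\<Sum>\<^sub>\<infinity>x. log_term p (u x)))) UNIV"
    using action_density_summable[of p V, OF assms] admissibleD(3)[OF assms(3)]
    unfolding action_def by (intro has_sum_add) auto
  moreover have "(\<lambda>x. action_density p V u x + log_term p (u x))
      = (\<lambda>x. grad_norm p u x powr p + V x * \<bar>u x\<bar> powr p)"
    by (simp add: action_density_def grad_norm_powr[OF assms(1)])
  ultimately show ?thesis by (simp add: ext_integral_eq_infsum has_sum_iff)
qed

lemma energy_eq:
  assumes "p > 0" "\<And>x. \<bar>V x\<bar> \<le> K" "admissible p u"
  shows "energy p V u = ereal ((action p V u + mass p u) / p)"
proof -
  have "\<bar>V x + 1\<bar> \<le> K + 1" for x using assms(2)[of x] by linarith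
  note e = ext_integral_dirichlet[of p "\<lambda>x. V x + 1", OF assms(1) this assms(3)]
  have "action_density p (\<lambda>x. V x + 1) u x = action_density p V u x + \<bar>u x\<bar> powr p" for x
    by (simp add: action_density_def algebra_simps)
  then have "action p (\<lambda>x. V x + 1) u = action p V u + mass p u"
    unfolding action_def mass_def
    using action_density_summable[of p V, OF assms] admissibleD(2)[OF assms(3)]
    by (simp add: infsum_add cong: infsum_cong)
  then show ?thesis
    using e unfolding energy_def log_integral_eq[OF assms(3)]
    by (simp add: add_divide_distrib)
qed

text \<open>The positive part of $|u|^p\log|u|^p$ is always summable, since $\log|u|^p$ is bounded
  above by a constant depending on the mass. So finite energy can only fail through the negative
  part, and then the logarithmic integral is $-\infty$ and the energy $+\infty$.\<close>

lemma energy_dom_iff_admissible: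
  fixes u V :: "int ^ 'n \<Rightarrow> real"
  assumes p: "p > 0" and K: "\<And>x. \<bar>V x\<bar> \<le> K"
  shows "u \<in> energy_dom p V \<longleftrightarrow> admissible p u"
proof
  assume "admissible p u"
  then show "u \<in> energy_dom p V"
    using energy_eq[of p V, OF p K] by (simp add: energy_dom_def W1p_iff_lp_summable[OF p] admissible_def)
next
  assume "u \<in> energy_dom p V"
  then have lp: "lp_summable p u" and fin: "energy p V u < \<infinity>"
    by (auto simp: energy_dom_def W1p_iff_lp_summable[OF p])
  let ?f = "\<lambda>x. log_term p (u x)"
  have "?f summable_on UNIV"
  proof (rule ccontr)
    assume "\<not> ?f summable_on UNIV"
    then have "\<not> integrable (count_space UNIV) ?f" by (simp add: integrable_count_space_iff_summable_on)
    moreover have "(\<integral>\<^sup>+x. ennreal (?f x) \<partial>count_space UNIV) \<noteq> \<infinity>"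
    proof -
      \<comment> \<open>The summand one keeps the constant nonnegative and the argument positive.\<close>
      define c where "c = ln (1 + mass p u)"
      have c: "0 \<le> c" using mass_nonneg[of p u] by (simp add: c_def)
      have "?f x \<le> c * \<bar>u x\<bar> powr p" for x
      proof (cases "u x = 0")
        case False
        then have "ln (\<bar>u x\<bar> powr p) \<le> c"
          unfolding c_def using mass_ge_single[OF lp, of x] mass_nonneg[of p u]
          by (subst ln_le_cancel_iff) auto
        then show ?thesis unfolding log_term_def by (subst mult.commute) (intro mult_right_mono, auto)
      qed simp
      then have "(\<integral>\<^sup>+x. ennreal (?f x) \<partial>count_space UNIV)
          \<le> (\<integral>\<^sup>+x. ennreal (c * \<bar>u x\<bar> powr p) \<partial>count_space UNIV)"
        by (intro nn_integral_mono ennreal_leI)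
      moreover have "integrable (count_space UNIV) (\<lambda>x. c * \<bar>u x\<bar> powr p)"
        using lp by (auto simp: integrable_count_space_iff_summable_on lp_summable_def
            intro: summable_on_cmult_right)
      then have "(\<integral>\<^sup>+x. ennreal (c * \<bar>u x\<bar> powr p) \<partial>count_space UNIV) \<noteq> \<infinity>"
        unfolding real_integrable_def by blast
      ultimately show ?thesis by (auto simp: top_unique)
    qed
    ultimately have "(\<integral>\<^sup>+x. ennreal (- ?f x) \<partial>count_space UNIV) = \<infinity>"
      by (auto simp: real_integrable_def)
    moreover have "enn2ereal (\<integral>\<^sup>+x. ennreal (?f x) \<partial>count_space UNIV) \<noteq> \<infinity>"
      using \<open>(\<integral>\<^sup>+x. ennreal (?f x) \<partial>count_space UNIV) \<noteq> \<infinity>\<close>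
      by (metis enn2ereal_inject enn2ereal_top infinity_ennreal_def)
    ultimately have "log_integral p u = - \<infinity>"
      unfolding log_integral_def ext_integral_def log_term_def[symmetric]
      by (cases "enn2ereal (\<integral>\<^sup>+x. ennreal (?f x) \<partial>count_space UNIV)") auto
    moreover have "\<exists>r. ext_integral (\<lambda>x. grad_norm p u x powr p + (V x + 1) * \<bar>u x\<bar> powr p) = ereal r"
    proof -
      have "\<bar>V x + 1\<bar> \<le> K + 1" for x using K[of x] by linarith
      from potential_term_summable[of "\<lambda>x. V x + 1", OF this lp] grad_density_summable(1)[OF p lp]
      have "(\<lambda>x. grad_density p u x + (V x + 1) * \<bar>u x\<bar> powr p) summable_on UNIV"
        by (intro summable_on_add)
      from ext_integral_eq_infsum[OF this] show ?thesis by (simp add: grad_norm_powr[OF p])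
    qed
    ultimately show False using fin p by (auto simp: energy_def)
  qed
  then show "admissible p u" using lp by (simp add: admissible_def)
qed

lemma nehari_iff:
  fixes u V :: "int ^ 'n \<Rightarrow> real"
  assumes p: "p > 0" and K: "\<And>x. \<bar>V x\<bar> \<le> K"
  shows "u \<in> nehari p V \<longleftrightarrow> admissible p u \<and> u \<noteq> (\<lambda>x. 0) \<and> action p V u = 0"
  using ext_integral_dirichlet[of p V, OF p K] log_integral_eq[of p u]
  by (auto simp: nehari_def energy_dom_iff_admissible[of p V, OF p K])

lemma sgn_powr_scale: "t > 0 \<Longrightarrow> sgn_powr q (t * a) = t powr q * t * sgn_powr q a"
  by (simp add: sgn_powr_def abs_mult powr_mult)

lemma p_laplacian_scale:
  assumes "t > 0"
  shows "p_laplacian p (\<lambda>x. t * u x) x = t powr (p - 2) * t * p_laplacian p u x"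
  unfolding p_laplacian_def sum_distrib_left
  by (simp add: right_diff_distrib[symmetric] sgn_powr_scale[OF assms])

section \<open>Existence of a signed ground state\<close>

theorem theorem6p6:
  fixes p Vinf :: real
    and V :: "int ^ 'n \<Rightarrow> real"
  assumes "p > 1"
    and "- 1 < (INF x. ereal (V x))"
    and "(SUP x. ereal (V x)) = ereal Vinf"
    and "(V \<longlongrightarrow> Vinf) (filtercomap lattice_norm at_top)"
  shows "\<exists>u. is_ground_state p V u \<and> ((\<forall>x. u x > 0) \<or> (\<forall>x. u x < 0))"
proof -
  have p: "p > 0" using assms(1) by simp
  have Vlo: "- 1 < V x" for x
  proof -
    have "- 1 < ereal (V x)" using assms(2) by (rule less_le_trans) (auto intro: INF_lower)
    then show ?thesis unfolding one_ereal_def uminus_ereal.simps(1) less_ereal.simps(1) .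
  qed
  have Vle: "V x \<le> Vinf" for x
    using SUP_upper[of x UNIV "\<lambda>x. ereal (V x)"] assms(3) by simp
  define K where "K = max 1 \<bar>Vinf\<bar>"
  have K: "\<bar>V x\<bar> \<le> K" for x using Vlo[of x] Vle[of x] by (auto simp: K_def abs_if max_def)
  have K': "\<bar>Vinf\<bar> \<le> K" by (simp add: K_def)
  obtain w where w: "admissible p w" "mass p w = 1" "\<And>x. 0 \<le> w x"
    and min: "\<And>v. admissible p v \<Longrightarrow> mass p v = 1 \<Longrightarrow> action p V w \<le> action p V v"
    using action_minimizer_exists[OF assms(1) K K' Vle assms(4)] by blast
  define I where "I = action p V w"
  have el: "- p_laplacian p w x + V x * sgn_powr (p - 2) (w x)
      = sgn_powr (p - 2) (w x) * (ln (\<bar>w x\<bar> powr p) + I)" for x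
    unfolding I_def by (rule minimizer_euler_lagrange[OF assms(1) K w(1,2) min])
  have w_ne: "w \<noteq> (\<lambda>x. 0)" using w(2) by (auto simp: mass_def)
  have w_pos: "0 < w x" for x by (rule minimizer_positive[OF w(3) w_ne el])
  \<comment> \<open>The unique scaling that brings the action of \<open>w\<close> to zero; its logarithm absorbs the Lagrange multiplier.\<close>
  define t where "t = exp (I / p)"
  define u where "u = (\<lambda>x. t * w x)"
  have t: "t > 0" "t powr p = exp I" "p * ln t = I" using p by (auto simp: t_def powr_def)
  have u_adm: "admissible p u" unfolding u_def by (rule admissible_scale[OF t(1) w(1)])
  have u_mass: "mass p u = exp I" unfolding u_def mass_scale[OF t(1)] t(2) w(2) by simp
  have u_act: "action p V u = 0"
    unfolding u_def action_scale[of p V, OF p K t(1) w(1)] t(3) w(2) I_def by simp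
  have u_pos: "0 < u x" for x using w_pos t(1) by (simp add: u_def)
  have u_ne: "u \<noteq> (\<lambda>x. 0)" using u_pos[of undefined] by auto
  have u_neh: "u \<in> nehari p V" using u_adm u_ne u_act by (simp add: nehari_iff[of p V, OF p K])
  have "energy p V u \<le> energy p V v" if v: "v \<in> nehari p V" for v
  proof -
    have v': "admissible p v" "v \<noteq> (\<lambda>x. 0)" "action p V v = 0"
      using v by (auto simp: nehari_iff[of p V, OF p K])
    have m: "mass p v > 0"
      using mass_nonneg[of p v] mass_eq_0_iff[OF admissibleD(1)[OF v'(1)]] v'(2) by linarith
    have "mass p v * (I - ln (mass p v)) \<le> 0"
      using action_ge_of_unit_mass_bound[of p V, OF p K v'(1), of I] min v'(3) by (simp add: I_def)
    then have "I \<le> ln (mass p v)" using m by (simp add: mult_le_0_iff)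
    then have "exp I \<le> mass p v" using m by (simp add: ln_ge_iff)
    then show ?thesis
      using p unfolding energy_eq[of p V, OF p K u_adm] energy_eq[of p V, OF p K v'(1)] u_act v'(3) u_mass
      by (simp add: divide_right_mono)
  qed
  then have inf: "energy p V u = (INF v\<in>nehari p V. energy p V v)"
    by (intro antisym INF_greatest INF_lower u_neh)
  have "- p_laplacian p u x + V x * sgn_powr (p - 2) (u x)
      = sgn_powr (p - 2) (u x) * ln (\<bar>u x\<bar> powr p)" for x
  proof -
    have "ln (\<bar>u x\<bar> powr p) = ln (\<bar>w x\<bar> powr p) + I"
      using t w_pos[of x] by (simp add: u_def abs_mult ln_powr ln_mult distrib_left)
    then have "- p_laplacian p u x + V x * sgn_powr (p - 2) (u x) - sgn_powr (p - 2) (u x) * ln (\<bar>u x\<bar> powr p)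
      = t powr (p - 2) * t * (- p_laplacian p w x + V x * sgn_powr (p - 2) (w x)
          - sgn_powr (p - 2) (w x) * (ln (\<bar>w x\<bar> powr p) + I))"
      unfolding u_def by (simp add: p_laplacian_scale[OF t(1)] sgn_powr_scale[OF t(1)] algebra_simps)
    then show ?thesis using el[of x] by simp
  qed
  then have "is_ground_state p V u"
    using u_adm u_ne inf by (simp add: is_ground_state_def is_solution_def energy_dom_iff_admissible[of p V, OF p K])
  then show ?thesis using u_pos by blast
qed

end
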